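(* There is an absolute constant $C>0$ such that the following holds. Let $(X_t)_{t=-\infty}^\infty$ be a centred weakly stationary real time series with $\mathbb{E}X_t^2\leqslant 1$. Let $\{\varphi_k\}_{k=1}^\infty$ be a non-increasing sequence of non-negative numbers such that, for all integers $i<j<k<l$, $$|\mathrm{Cov}(X_i,X_jX_kX_l)|\leqslant \varphi_{j-i},\quad |\mathrm{Cov}(X_iX_jX_k,X_l)|\leqslant \varphi_{l-k},$$ $$|\mathrm{Cov}(X_iX_j,X_kX_l)|\leqslant \varphi_{k-j},\quad |\mathrm{Cov}(X_i,X_j)|\leqslant \varphi_{j-i},$$ and let $\{\phi_k\}_{k=1}^\infty$ be a sequence of non-negative numbers such that $\mathrm{Cov}(X_i^2,X_j^2)\leqslant \phi_{j-i}$ for all integers $i<j$. Assume that $\Phi_0=\sup_t\mathbb{E}X_t^4$, $\Phi_1=\sum_{k=1}^\infty k\varphi_k$ and $\Phi_2=\sum_{k=1}^\infty\phi_k$ are finite. Let $K:[0,\infty)\to\mathbb{R}$ satisfy (a) $K(0)=1$, $K$ is continuous at $x=0$, and $\sup_{x\geqslant 0}|K(x)|<\infty$; (b) $\int_0^\infty \bar{K}^2(x)\,dx<\infty$, where $\bar{K}(x)=\sup_{y\geqslant x}|K(y)|$; (c) for some $q>0$, the (finite) limit $k_q=\lim_{x\to0+}x^{-q}(K(x)-1)$ exists. Assume further that, for this $q$, the series $\Gamma_q=\sum_{j=1}^\infty j^q\,\mathrm{Cov}(X_t,X_{t+j})$ converges absolutely. Let $$\widehat{\sigma}_n^2=\frac{1}{n}\sum_{s,t=1}^n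 K\Big(\frac{|s-t|}{m}\Big)X_sX_t,\qquad \sigma^2=\sum_{j=-\infty}^\infty\mathrm{Cov}(X_t,X_{t+j}).$$ Then, as $m,n\to\infty$, $$\mathbb{E}|\widehat{\sigma}_n^2-\sigma^2|^2\leqslant C(\Phi_0+\Phi_1+\Phi_2)\frac{m}{n}\int_0^\infty\bar{K}^2(x)\,dx+\frac{4(k_q\Gamma_q)^2}{m^{2q}}+o(m^{-2q})+O(n^{-1}).$$
   Context: Weakly stationary means that $\mathbb{E}X_t$ and $\mathrm{Cov}(X_t,X_{t+j})$ do not depend on $t$. Here $m>0$ is the bandwidth parameter of the estimator $\widehat{\sigma}_n^2$ (which depends on both $m$ and $n$). The constant $C$ does not depend on the time series, $K$, $q$, $m$ or $n$; the $o(\cdot)$ and $O(\cdot)$ terms are for $m,n\to\infty$ with the time series, the coefficient sequences, $K$ and $q$ fixed (and may depend on these). *)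

theory Defs
  imports "HOL-Probability.Probability" "HOL-Library.Landau_Symbols"
begin

definition cov :: "'a measure \<Rightarrow> ('a \<Rightarrow> real) \<Rightarrow> ('a \<Rightarrow> real) \<Rightarrow> real" where
  "cov M X Y = (\<integral>\<omega>. (X \<omega> - (\<integral>\<omega>'. X \<omega>' \<partial>M)) * (Y \<omega> - (\<integral>\<omega>'. Y \<omega>' \<partial>M)) \<partial>M)"

definition weakly_stationary :: "'a measure \<Rightarrow> (int \<Rightarrow> 'a \<Rightarrow> real) \<Rightarrow> bool" where
  "weakly_stationary M X \<longleftrightarrow>
     (\<forall>t. X t \<in> borel_measurable M \<and> integrable M (X t) \<and> integrable M (\<lambda>\<omega>. (X t \<omega>)\<^sup>2)) \<and>
     (\<forall>s t. (\<integral>\<omega>. X s \<omega> \<partial>M) = (\<integral>\<omega>. X t \<omega> \<partial>M)) \<and>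
     (\<forall>s t j. cov M (X s) (X (s + j)) = cov M (X t) (X (t + j)))"

text \<open>The sequences $(\varphi_k)_{k\ge 1}$ and $(\phi_k)_{k\ge 1}$ are written \<open>\<phi>\<close> and \<open>\<psi>\<close>;
  both are functions on the natural numbers whose value at 0 is never used.\<close>

definition dependence_bounds ::
  "'a measure \<Rightarrow> (int \<Rightarrow> 'a \<Rightarrow> real) \<Rightarrow> (nat \<Rightarrow> real) \<Rightarrow> (nat \<Rightarrow> real) \<Rightarrow> bool" where
  "dependence_bounds M X \<phi> \<psi> \<longleftrightarrow>
     (\<forall>k\<ge>1. 0 \<le> \<phi> k) \<and> (\<forall>k\<ge>1. \<forall>l\<ge>k. \<phi> l \<le> \<phi> k) \<and>
     (\<forall>i j k l. i < j \<and> j < k \<and> k < l \<longrightarrow>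
        \<bar>cov M (X i) (\<lambda>\<omega>. X j \<omega> * X k \<omega> * X l \<omega>)\<bar> \<le> \<phi> (nat (j - i)) \<and>
        \<bar>cov M (\<lambda>\<omega>. X i \<omega> * X j \<omega> * X k \<omega>) (X l)\<bar> \<le> \<phi> (nat (l - k)) \<and>
        \<bar>cov M (\<lambda>\<omega>. X i \<omega> * X j \<omega>) (\<lambda>\<omega>. X k \<omega> * X l \<omega>)\<bar> \<le> \<phi> (nat (k - j)) \<and>
        \<bar>cov M (X i) (X j)\<bar> \<le> \<phi> (nat (j - i))) \<and>
     (\<forall>k\<ge>1. 0 \<le> \<psi> k) \<and>
     (\<forall>i j. i < j \<longrightarrow> cov M (\<lambda>\<omega>. (X i \<omega>)\<^sup>2) (\<lambda>\<omega>. (X j \<omega>)\<^sup>2) \<le> \<psi> (nat (j - i)))"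

text \<open>The three quantities below are meaningful only under the finiteness conditions in
  \<open>finite_Phis\<close>.\<close>

definition Phi0 :: "'a measure \<Rightarrow> (int \<Rightarrow> 'a \<Rightarrow> real) \<Rightarrow> real" where
  "Phi0 M X = (SUP t. \<integral>\<omega>. (X t \<omega>) ^ 4 \<partial>M)"

definition Phi1 :: "(nat \<Rightarrow> real) \<Rightarrow> real" where
  "Phi1 \<phi> = (\<Sum>k. real (Suc k) * \<phi> (Suc k))"

definition Phi2 :: "(nat \<Rightarrow> real) \<Rightarrow> real" where
  "Phi2 \<psi> = (\<Sum>k. \<psi> (Suc k))"

definition finite_Phis ::
  "'a measure \<Rightarrow> (int \<Rightarrow> 'a \<Rightarrow> real) \<Rightarrow> (nat \<Rightarrow> real) \<Rightarrow> (nat \<Rightarrow> real) \<Rightarrow> bool" where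
  "finite_Phis M X \<phi> \<psi> \<longleftrightarrow>
     (\<forall>t. integrable M (\<lambda>\<omega>. (X t \<omega>) ^ 4)) \<and>
     bdd_above (range (\<lambda>t. \<integral>\<omega>. (X t \<omega>) ^ 4 \<partial>M)) \<and>
     summable (\<lambda>k. real (Suc k) * \<phi> (Suc k)) \<and>
     summable (\<lambda>k. \<psi> (Suc k))"

text \<open>A kernel $K : [0,\infty)\to\mathbb{R}$ is a function on the reals of which only the values on
  \<open>{0..}\<close> are used.\<close>

definition Kbar :: "(real \<Rightarrow> real) \<Rightarrow> real \<Rightarrow> real" where
  "Kbar K x = (SUP y\<in>{x..}. \<bar>K y\<bar>)"

definition kernel_conditions :: "(real \<Rightarrow> real) \<Rightarrow> real \<Rightarrow> real \<Rightarrow> bool" where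
  "kernel_conditions K q kq \<longleftrightarrow>
     K 0 = 1 \<and> continuous (at 0 within {0..}) K \<and> bdd_above ((\<lambda>x. \<bar>K x\<bar>) ` {0..}) \<and>
     set_integrable lborel {0..} (\<lambda>x. (Kbar K x)\<^sup>2) \<and>
     0 < q \<and> ((\<lambda>x. x powr (- q) * (K x - 1)) \<longlongrightarrow> kq) (at_right 0)"

text \<open>By weak stationarity the autocovariances may be taken at time origin 0.\<close>

definition Gamma_term :: "'a measure \<Rightarrow> (int \<Rightarrow> 'a \<Rightarrow> real) \<Rightarrow> real \<Rightarrow> nat \<Rightarrow> real" where
  "Gamma_term M X q j = real (Suc j) powr q * cov M (X 0) (X (int (Suc j)))"

definition long_run_variance :: "'a measure \<Rightarrow> (int \<Rightarrow> 'a \<Rightarrow> real) \<Rightarrow> real" where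
  "long_run_variance M X = (\<Sum>\<^sub>\<infinity>j\<in>(UNIV :: int set). cov M (X 0) (X j))"

definition lrv_estimator ::
  "(real \<Rightarrow> real) \<Rightarrow> (int \<Rightarrow> 'a \<Rightarrow> real) \<Rightarrow> real \<Rightarrow> nat \<Rightarrow> 'a \<Rightarrow> real" where
  "lrv_estimator K X m n \<omega> =
     (1 / real n) * (\<Sum>s\<in>{1..int n}. \<Sum>t\<in>{1..int n}. K (real_of_int \<bar>s - t\<bar> / m) * X s \<omega> * X t \<omega>)"

definition mse ::
  "'a measure \<Rightarrow> (real \<Rightarrow> real) \<Rightarrow> (int \<Rightarrow> 'a \<Rightarrow> real) \<Rightarrow> real \<Rightarrow> nat \<Rightarrow> real" where
  "mse M K X m n = (\<integral>\<omega>. \<bar>lrv_estimator K X m n \<omega> - long_run_variance M X\<bar>\<^sup>2 \<partial>M)"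

text \<open>\<open>mse_bound_constant TYPE('a) C\<close>: the asymptotic bound holds with constant \<open>C\<close> for every time
  series, defined on a probability space with sample points of type \<open>'a\<close>, and every kernel that
  satisfy the hypotheses. The remainders are functions of the real bandwidth \<open>m\<close> and the
  sample size \<open>n\<close>, and they may depend on everything else; the limit is the joint one, with no
  relation imposed between \<open>m\<close> and \<open>n\<close>.

  The type of the sample points has to be an argument, because a statement
  \<open>\<exists>C. mse_bound_constant TYPE('a) C\<close> would let \<open>C\<close> depend on \<open>'a\<close>, and so on the probability
  space. To express that \<open>C\<close> is absolute, one asks for \<open>C\<close> on the path space \<open>int \<Rightarrow> real\<close>,
  together with the assertion that each \<open>C\<close> valid there is valid for every other type of sample
  points.\<close>

definition mse_bound_constant :: "'a itself \<Rightarrow> real \<Rightarrow> bool" where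
  "mse_bound_constant TYPE('a) C \<longleftrightarrow>
     (\<forall>(M :: 'a measure) X \<phi> \<psi> K q kq.
        prob_space M \<longrightarrow>
        weakly_stationary M X \<longrightarrow>
        (\<forall>t. (\<integral>\<omega>. X t \<omega> \<partial>M) = 0) \<longrightarrow>
        (\<forall>t. (\<integral>\<omega>. (X t \<omega>)\<^sup>2 \<partial>M) \<le> 1) \<longrightarrow>
        dependence_bounds M X \<phi> \<psi> \<longrightarrow>
        finite_Phis M X \<phi> \<psi> \<longrightarrow>
        kernel_conditions K q kq \<longrightarrow>
        summable (\<lambda>j. \<bar>Gamma_term M X q j\<bar>) \<longrightarrow>
        (\<exists>R S :: real \<times> nat \<Rightarrow> real.
           R \<in> o[at_top \<times>\<^sub>F at_top](\<lambda>(m, n). m powr (- 2 * q)) \<and>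
           S \<in> O[at_top \<times>\<^sub>F at_top](\<lambda>(m, n). 1 / real n) \<and>
           (\<forall>\<^sub>F (m, n) in at_top \<times>\<^sub>F at_top.
              mse M K X m n \<le>
                C * (Phi0 M X + Phi1 \<phi> + Phi2 \<psi>) * (m / real n)
                  * (LINT x:{0..}|lborel. (Kbar K x)\<^sup>2)
                + 4 * (kq * (\<Sum>j. Gamma_term M X q j))\<^sup>2 / m powr (2 * q)
                + R (m, n) + S (m, n))))"

end

theory Submission
  imports Defs
begin

text \<open>The mean squared error is the variance of the estimator plus the square of its bias.

  \<^bold>\<open>Bias.\<close> Let \<open>\<gamma> j\<close> be the autocovariances. Up to an error of order \<open>1 / n\<close>, which comes from
  \<open>\<Sum>j. j * \<bar>\<gamma> j\<bar> < \<infinity>\<close>, the bias is \<open>2 * (\<Sum>j\<ge>1. (K (j / m) - 1) * \<gamma> j)\<close>. After multiplication by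
  \<open>m powr q\<close> each summand tends to \<open>kq * j powr q * \<gamma> j\<close>, and dominated convergence for series
  gives the limit \<open>2 * kq * \<Gamma>\<close>. This is the term with the factor 4 in the bound
  (\<open>toeplitz_sum_approx\<close>, \<open>kernel_bias_tendsto\<close>).

  \<^bold>\<open>Variance.\<close> The diagonal terms \<open>X s\<^sup>2\<close> contribute \<open>O(1 / n)\<close>, because their covariances are
  summable. What is left is the variance of the quadratic form with coefficients
  \<open>a s t = K (\<bar>s - t\<bar> / m)\<close> for \<open>s \<noteq> t\<close>, a sum over pairs of pairs \<open>{s, t}\<close>, \<open>{u, v}\<close>.

  If the four indices are distinct, the dependence bounds control the covariance of \<open>X s * X t\<close>
  and \<open>X u * X v\<close> by the value of \<open>\<phi>\<close> at the larger of two of the three gaps between the ordered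
  indices, and one can choose these two gaps so that \<open>\<bar>a s t * a u v\<bar>\<close> is bounded by the square of a
  decreasing majorant at the third, or by the mean of two such squares for two choices. The sum over
  the first two gaps is at most a multiple of \<open>\<Sum>k. k * \<phi> k\<close>, the sum over the third gap is at most
  a multiple of \<open>m * (\<integral> Kbar\<^sup>2)\<close>, and the position of the quadruple gives a factor \<open>n\<close>
  (\<open>sum_edges_le\<close>).

  If the pairs share an index, the dependence bounds give no information on moments like
  \<open>E (X s\<^sup>2 * X t * X u)\<close>. These terms are collected for each shared index \<open>s\<close> into the variance
  of \<open>X s * U s\<close> with \<open>U s = (\<Sum>t. a s t * X t)\<close> (\<open>square_sum_array_le\<close>). By the arithmetic-geometric
  inequality it is enough to bound the fourth moment of the linear combination \<open>U s\<close> by a multiple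
  of the square of \<open>\<Sum>t. (a s t)\<^sup>2\<close> (\<open>fourth_moment_le\<close>). There the same problem with repeated
  indices arises, and it disappears because the terms with repeated indices
  can be absorbed pointwise into the fourth power itself (\<open>power4_sum_le\<close>).

  Finally, a constant that works on the path space \<open>int \<Rightarrow> real\<close> works everywhere, since every
  quantity in the statement depends only on the law of the series.\<close>

section \<open>Sums over lags\<close>

text \<open>Every lag occurs at most twice among the integers, once with each sign.\<close>

lemma sum_abs_int_le:
  fixes g :: "nat \<Rightarrow> real" and J :: "int set"
  assumes "finite J" "0 \<notin> J" and nn: "\<And>k. 1 \<le> k \<Longrightarrow> 0 \<le> g k" and B: "\<And>N. (\<Sum>k<N. g (Suc k)) \<le> B"
  shows "(\<Sum>y\<in>J. g (nat \<bar>y\<bar>)) \<le> 2 * B"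
proof -
  have half: "(\<Sum>y\<in>A. g (nat \<bar>y\<bar>)) \<le> B"
    if A: "A \<subseteq> J" and inj: "inj_on abs A" for A
  proof -
    let ?h = "\<lambda>y::int. nat \<bar>y\<bar> - 1"
    have nz: "y \<noteq> 0" if "y \<in> A" for y using that A assms(2) by auto
    have fA: "finite A" using A assms(1) finite_subset by blast
    have injh: "inj_on ?h A"
    proof (rule inj_onI)
      fix x y assume xy: "x \<in> A" "y \<in> A" "?h x = ?h y"
      then have "\<bar>x\<bar> = \<bar>y\<bar>" using nz[of x] nz[of y] by linarith
      then show "x = y" using inj xy by (auto dest: inj_onD)
    qed
    obtain N where N: "?h ` A \<subseteq> {..<N}"
      using finite_nat_iff_bounded[of "?h ` A"] fA by auto
    have "(\<Sum>y\<in>A. g (nat \<bar>y\<bar>)) = (\<Sum>y\<in>A. g (Suc (?h y)))"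
      by (rule sum.cong) (auto dest: nz)
    also have "\<dots> = (\<Sum>k\<in>?h ` A. g (Suc k))"
      by (rule sum.reindex[OF injh, of "\<lambda>k. g (Suc k)", unfolded o_def, symmetric])
    also have "\<dots> \<le> (\<Sum>k<N. g (Suc k))"
      using N nn by (intro sum_mono2) auto
    finally show ?thesis using B[of N] by linarith
  qed
  have "(\<Sum>y\<in>J. g (nat \<bar>y\<bar>))
      = (\<Sum>y\<in>J \<inter> {0<..}. g (nat \<bar>y\<bar>)) + (\<Sum>y\<in>J \<inter> {..<0}. g (nat \<bar>y\<bar>))"
    using assms(1,2) by (subst sum.union_disjoint[symmetric]) (auto intro!: sum.cong simp: not_less order_less_le)
  also have "\<dots> \<le> B + B"
    by (intro add_mono half) (auto simp: inj_on_def)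
  finally show ?thesis by simp
qed

text \<open>\<open>\<phi>\<close> at the larger of two gaps. The value 0 when a gap vanishes makes sums over all pairs of
  integers equal to sums over the pairs of proper gaps, and \<open>\<phi> 0\<close> never enters.\<close>

definition lag_bound :: "(nat \<Rightarrow> real) \<Rightarrow> int \<Rightarrow> int \<Rightarrow> real" where
  "lag_bound \<phi> y z = (if y = 0 \<or> z = 0 then 0 else \<phi> (nat (max \<bar>y\<bar> \<bar>z\<bar>)))"

text \<open>There are at most \<open>8 * k\<close> pairs of non-zero integers with maximal absolute value \<open>k\<close>; this is
  where the weight \<open>k\<close> in \<open>\<Sum>k. k * \<phi> k\<close> is used. Indexing the pairs by an injective map of a finite
  set makes the bound applicable to gaps between arbitrary indices.\<close>

lemma sum_lag_bound_le:
  assumes "finite S" and inj: "inj_on (\<lambda>x. (f x :: int, g x :: int)) S"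
    and nn: "\<And>k. 1 \<le> k \<Longrightarrow> 0 \<le> \<phi> k"
    and B: "\<And>N. (\<Sum>k<N. real (Suc k) * \<phi> (Suc k)) \<le> B"
  shows "(\<Sum>x\<in>S. lag_bound \<phi> (f x) (g x)) \<le> 8 * B"
proof -
  define N where "N = Max (insert 0 ((\<lambda>x. \<bar>f x\<bar>) ` S \<union> (\<lambda>x. \<bar>g x\<bar>) ` S))"
  define J where "J = {-N..N} - {0}"
  have N: "\<bar>f x\<bar> \<le> N" "\<bar>g x\<bar> \<le> N" if "x \<in> S" for x
    unfolding N_def using that \<open>finite S\<close> by (auto intro!: Max_ge)
  have lnn: "0 \<le> lag_bound \<phi> y z" for y z
    unfolding lag_bound_def using nn by auto
  have one: "(\<Sum>y\<in>J. \<Sum>z\<in>J. if \<bar>z\<bar> \<le> \<bar>y\<bar> then \<phi> (nat \<bar>y\<bar>) else 0) \<le> 4 * B"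
  proof -
    have "(\<Sum>y\<in>J. \<Sum>z\<in>J. if \<bar>z\<bar> \<le> \<bar>y\<bar> then \<phi> (nat \<bar>y\<bar>) else 0)
        \<le> (\<Sum>y\<in>J. 2 * (real (nat \<bar>y\<bar>) * \<phi> (nat \<bar>y\<bar>)))"
    proof (rule sum_mono)
      fix y assume "y \<in> J"
      then have p: "0 \<le> \<phi> (nat \<bar>y\<bar>)" by (intro nn) (auto simp: J_def)
      have "card (J \<inter> {z. \<bar>z\<bar> \<le> \<bar>y\<bar>}) \<le> card ({-\<bar>y\<bar>..\<bar>y\<bar>} - {0})"
        by (rule card_mono) (auto simp: J_def)
      also have "\<dots> = 2 * nat \<bar>y\<bar>" by (subst card_Diff_singleton) auto
      finally have c: "real (card (J \<inter> {z. \<bar>z\<bar> \<le> \<bar>y\<bar>})) \<le> 2 * real (nat \<bar>y\<bar>)" by linarith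
      have "(\<Sum>z\<in>J. if \<bar>z\<bar> \<le> \<bar>y\<bar> then \<phi> (nat \<bar>y\<bar>) else 0)
          = real (card (J \<inter> {z. \<bar>z\<bar> \<le> \<bar>y\<bar>})) * \<phi> (nat \<bar>y\<bar>)"
        by (subst sum.inter_restrict[symmetric, where B="{z. \<bar>z\<bar> \<le> \<bar>y\<bar>}", simplified]) (auto simp: J_def)
      also have "\<dots> \<le> (2 * real (nat \<bar>y\<bar>)) * \<phi> (nat \<bar>y\<bar>)"
        by (rule mult_right_mono[OF c p])
      finally show "(\<Sum>z\<in>J. if \<bar>z\<bar> \<le> \<bar>y\<bar> then \<phi> (nat \<bar>y\<bar>) else 0) \<le> 2 * (real (nat \<bar>y\<bar>) * \<phi> (nat \<bar>y\<bar>))"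
        by simp
    qed
    also have "\<dots> = 2 * (\<Sum>y\<in>J. real (nat \<bar>y\<bar>) * \<phi> (nat \<bar>y\<bar>))"
      by (simp only: sum_distrib_left)
    also have "\<dots> \<le> 2 * (2 * B)"
      by (intro mult_left_mono sum_abs_int_le[where g="\<lambda>k. real k * \<phi> k"]) (use nn B in \<open>auto simp: J_def\<close>)
    finally show ?thesis by simp
  qed
  have "(\<Sum>x\<in>S. lag_bound \<phi> (f x) (g x)) = (\<Sum>(y,z)\<in>(\<lambda>x. (f x, g x)) ` S. lag_bound \<phi> y z)"
    by (simp add: sum.reindex[OF inj] o_def)
  also have "\<dots> \<le> (\<Sum>(y,z)\<in>insert 0 J \<times> insert 0 J. lag_bound \<phi> y z)"
  proof (rule sum_mono2)
    show "(\<lambda>x. (f x, g x)) ` S \<subseteq> insert 0 J \<times> insert 0 J"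
    proof (rule image_subsetI)
      fix x assume "x \<in> S"
      then show "(f x, g x) \<in> insert 0 J \<times> insert 0 J" using N[of x] by (auto simp: J_def)
    qed
  qed (use lnn in \<open>auto simp: J_def\<close>)
  also have "\<dots> = (\<Sum>y\<in>J. \<Sum>z\<in>J. lag_bound \<phi> y z)"
  proof -
    have "finite J" "0 \<notin> J" by (auto simp: J_def)
    moreover have "lag_bound \<phi> 0 z = 0" "lag_bound \<phi> z 0 = 0" for z by (auto simp: lag_bound_def)
    ultimately show ?thesis unfolding sum.cartesian_product[symmetric] by simp
  qed
  also have "\<dots> \<le> (\<Sum>y\<in>J. \<Sum>z\<in>J. (if \<bar>z\<bar> \<le> \<bar>y\<bar> then \<phi> (nat \<bar>y\<bar>) else 0)
                    + (if \<bar>y\<bar> \<le> \<bar>z\<bar> then \<phi> (nat \<bar>z\<bar>) else 0))"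
    by (intro sum_mono) (auto simp: J_def lag_bound_def max_def intro!: nn)
  also have "\<dots> = (\<Sum>y\<in>J. \<Sum>z\<in>J. if \<bar>z\<bar> \<le> \<bar>y\<bar> then \<phi> (nat \<bar>y\<bar>) else 0)
      + (\<Sum>z\<in>J. \<Sum>y\<in>J. if \<bar>y\<bar> \<le> \<bar>z\<bar> then \<phi> (nat \<bar>z\<bar>) else 0)"
    by (subst (2) sum.swap) (simp only: sum.distrib)
  also have "\<dots> \<le> 4 * B + 4 * B" by (intro add_mono one)
  finally show ?thesis by simp
qed

text \<open>Index quadruples that are determined by one index and by three differences, the edges of a tree
  on the four indices: a sum of products of a function of one edge with the lag bound of the two
  other edges factorises.\<close>

lemma sum_edges_le:
  fixes \<kappa> :: "int \<Rightarrow> real"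
  assumes "finite S" "finite I" "base ` S \<subseteq> I"
    and inj: "inj_on (\<lambda>x. (base x, e x :: int, f x :: int, g x :: int)) S"
    and knn: "\<And>y. 0 \<le> \<kappa> y" and kB: "\<And>J. finite J \<Longrightarrow> (\<Sum>y\<in>J. \<kappa> y) \<le> A"
    and nn: "\<And>k. 1 \<le> k \<Longrightarrow> 0 \<le> \<phi> k"
    and B: "\<And>N. (\<Sum>k<N. real (Suc k) * \<phi> (Suc k)) \<le> B"
  shows "(\<Sum>x\<in>S. \<kappa> (e x) * lag_bound \<phi> (f x) (g x)) \<le> real (card I) * A * (8 * B)"
proof -
  let ?J = "e ` S" and ?R = "(\<lambda>x. (f x, g x)) ` S"
  have lnn: "0 \<le> lag_bound \<phi> y z" for y z
    unfolding lag_bound_def using nn by auto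
  have A: "0 \<le> A" using kB[of "{}"] by simp
  have "(\<Sum>x\<in>S. \<kappa> (e x) * lag_bound \<phi> (f x) (g x))
      = (\<Sum>(i,y,r)\<in>(\<lambda>x. (base x, e x, f x, g x)) ` S. \<kappa> y * lag_bound \<phi> (fst r) (snd r))"
    by (simp add: sum.reindex[OF inj] o_def)
  also have "\<dots> \<le> (\<Sum>(i,y,r)\<in>I \<times> ?J \<times> ?R. \<kappa> y * lag_bound \<phi> (fst r) (snd r))"
    using assms(1-3) knn lnn by (intro sum_mono2) auto
  also have "\<dots> = (\<Sum>i\<in>I. (\<Sum>y\<in>?J. \<kappa> y) * (\<Sum>r\<in>?R. lag_bound \<phi> (fst r) (snd r)))"
    by (simp add: sum.cartesian_product[symmetric] sum_product)
  also have "\<dots> = real (card I) * ((\<Sum>y\<in>?J. \<kappa> y) * (\<Sum>r\<in>?R. lag_bound \<phi> (fst r) (snd r)))"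
    by simp
  also have "\<dots> \<le> real (card I) * (A * (8 * B))"
    using assms(1) lnn A
    by (intro mult_left_mono mult_mono kB sum_lag_bound_le nn B sum_nonneg) (auto simp: inj_on_def)
  finally show ?thesis by (simp add: mult.assoc)
qed

lemma sum_int_lags_le:
  fixes b :: "nat \<Rightarrow> real"
  assumes "finite J" and nn: "\<And>k. 1 \<le> k \<Longrightarrow> 0 \<le> b k" and B: "\<And>N. (\<Sum>k<N. b (Suc k)) \<le> B"
  shows "(\<Sum>y\<in>J. if y = 0 then 0 else b (nat \<bar>y\<bar>)) \<le> 2 * B"
proof -
  have "(\<Sum>y\<in>J. if y = 0 then 0 else b (nat \<bar>y\<bar>)) = (\<Sum>y\<in>J - {0}. b (nat \<bar>y\<bar>))"
    using assms(1) by (intro sum.mono_neutral_cong_right) auto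
  also have "\<dots> \<le> 2 * B" by (intro sum_abs_int_le) (use assms in auto)
  finally show ?thesis .
qed

lemma sum_shifted_lags_le:
  fixes b :: "nat \<Rightarrow> real"
  assumes "finite I" and nn: "\<And>k. 1 \<le> k \<Longrightarrow> 0 \<le> b k" and B: "\<And>N. (\<Sum>k<N. b (Suc k)) \<le> B"
  shows "(\<Sum>t\<in>I. if s = t then 0 else b (nat \<bar>s - t\<bar>)) \<le> 2 * B"
proof -
  have inj: "inj_on (\<lambda>t. s - t) I" by (auto simp: inj_on_def)
  have "(\<Sum>t\<in>I. if s = t then 0 else b (nat \<bar>s - t\<bar>)) = (\<Sum>y\<in>(\<lambda>t. s - t) ` I. if y = 0 then 0 else b (nat \<bar>y\<bar>))"
    by (simp add: sum.reindex[OF inj] o_def)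
  also have "\<dots> \<le> 2 * B" by (intro sum_int_lags_le) (use assms in auto)
  finally show ?thesis .
qed

section \<open>Quadruples of distinct indices\<close>

definition quads :: "int set \<Rightarrow> (int \<times> int \<times> int \<times> int) set" where
  "quads I = {(s,t,u,v). s \<in> I \<and> t \<in> I \<and> u \<in> I \<and> v \<in> I \<and> distinct [s,t,u,v]}"

lemma finite_quads: "finite I \<Longrightarrow> finite (quads I)"
  by (rule finite_subset[of _ "I \<times> I \<times> I \<times> I"]) (auto simp: quads_def)

text \<open>The eight symmetries of a pair of pairs reduce to the case that each pair is ordered and that the
  first pair has the smaller left end.\<close>

lemma sum_quads_le:
  fixes F h :: "int \<Rightarrow> int \<Rightarrow> int \<Rightarrow> int \<Rightarrow> real"
  assumes sym: "\<And>s t u v. F t s u v = F s t u v" "\<And>s t u v. F u v s t = F s t u v"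
    and hnn: "\<And>s t u v. 0 \<le> h s t u v"
    and le: "\<And>s t u v. s < t \<Longrightarrow> u < v \<Longrightarrow> s < u \<Longrightarrow> distinct [s,t,u,v] \<Longrightarrow> F s t u v \<le> h s t u v"
  shows "(\<Sum>(s,t,u,v)\<in>quads I. F s t u v) \<le> 8 * (\<Sum>(s,t,u,v)\<in>quads I. h s t u v)"
proof -
  have sym2: "F s t v u = F s t u v" for s t u v
    using sym by metis
  note wit = sum.reindex_bij_witness
  have sw1: "(\<Sum>(s,t,u,v)\<in>quads I. k t s u v) = (\<Sum>(s,t,u,v)\<in>quads I. k s t u v)"
    for k :: "int \<Rightarrow> int \<Rightarrow> int \<Rightarrow> int \<Rightarrow> real"
    by (rule wit[where i="\<lambda>(s,t,u,v). (t,s,u,v)" and j="\<lambda>(s,t,u,v). (t,s,u,v)"]) (auto simp: quads_def)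
  have sw2: "(\<Sum>(s,t,u,v)\<in>quads I. k u v s t) = (\<Sum>(s,t,u,v)\<in>quads I. k s t u v)"
    for k :: "int \<Rightarrow> int \<Rightarrow> int \<Rightarrow> int \<Rightarrow> real"
    by (rule wit[where i="\<lambda>(s,t,u,v). (u,v,s,t)" and j="\<lambda>(s,t,u,v). (u,v,s,t)"]) (auto simp: quads_def)
  have sw3: "(\<Sum>(s,t,u,v)\<in>quads I. k s t v u) = (\<Sum>(s,t,u,v)\<in>quads I. k s t u v)"
    for k :: "int \<Rightarrow> int \<Rightarrow> int \<Rightarrow> int \<Rightarrow> real"
    by (rule wit[where i="\<lambda>(s,t,u,v). (s,t,v,u)" and j="\<lambda>(s,t,u,v). (s,t,v,u)"]) (auto simp: quads_def)
  define k where "k s t u v = h s t u v + h u v s t" for s t u v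
  define l where "l s t u v = k s t u v + k t s u v" for s t u v
  have knn: "0 \<le> k s t u v" for s t u v unfolding k_def using hnn by (simp add: add_nonneg_nonneg)
  have lnn: "0 \<le> l s t u v" for s t u v unfolding l_def using knn by (simp add: add_nonneg_nonneg)
  \<comment> \<open>\<open>k\<close> covers the exchange of the two pairs, \<open>l\<close> also the exchange within the first pair.\<close>
  have 1: "F s t u v \<le> k s t u v" if "s < t" "u < v" "distinct [s,t,u,v]" for s t u v
  proof (cases "s < u")
    case True
    then show ?thesis using le[of s t u v] that hnn[of u v s t] by (simp add: k_def)
  next
    case False
    then have "u < s" using that by auto
    then show ?thesis using le[of u v s t] that hnn[of s t u v] sym(2)[of u v s t] by (auto simp: k_def)
  qed
  have 2: "F s t u v \<le> l s t u v" if "u < v" "distinct [s,t,u,v]" for s t u v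
  proof (cases "s < t")
    case True
    then show ?thesis using 1[of s t u v] that knn[of t s u v] by (simp add: l_def)
  next
    case False
    then have "t < s" using that by auto
    then show ?thesis using 1[of t s u v] that knn[of s t u v] sym(1)[of t s u v] by (auto simp: l_def)
  qed
  have 3: "F s t u v \<le> l s t u v + l s t v u" if "distinct [s,t,u,v]" for s t u v
  proof (cases "u < v")
    case True
    then show ?thesis using 2[of u v s t] that lnn[of s t v u] by simp
  next
    case False
    then have "v < u" using that by auto
    then show ?thesis using 2[of v u s t] that lnn[of s t u v] sym2[of s t v u] by auto
  qed
  have "(\<Sum>(s,t,u,v)\<in>quads I. F s t u v) \<le> (\<Sum>(s,t,u,v)\<in>quads I. l s t u v + l s t v u)"
    by (rule sum_mono) (auto simp: quads_def intro!: 3)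
  also have "\<dots> = 2 * (\<Sum>(s,t,u,v)\<in>quads I. l s t u v)"
    using sw3[of l] by (simp add: sum.distrib split_def)
  also have "\<dots> = 4 * (\<Sum>(s,t,u,v)\<in>quads I. k s t u v)"
    using sw1[of k] by (simp add: l_def sum.distrib split_def)
  also have "\<dots> = 8 * (\<Sum>(s,t,u,v)\<in>quads I. h s t u v)"
    using sw2[of h] by (simp add: k_def sum.distrib split_def)
  finally show ?thesis .
qed

text \<open>Expand the square over pairs of pairs. Two pairs that share exactly one index appear in the
  squared row of that index, in four orientations; a pair combined with itself appears in two rows,
  and the excess that has to be subtracted is a sum of squares.\<close>

lemma square_sum_array_le:
  fixes y :: "int \<Rightarrow> int \<Rightarrow> real"
  assumes I: "finite I" and sym: "\<And>s t. y s t = y t s" and diag: "\<And>s. y s s = 0"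
  shows "(\<Sum>s\<in>I. \<Sum>t\<in>I. y s t)\<^sup>2 \<le> (\<Sum>(s,t,u,v)\<in>quads I. y s t * y u v) + 4 * (\<Sum>s\<in>I. (\<Sum>t\<in>I. y s t)\<^sup>2)"
proof -
  let ?T = "\<lambda>k. \<Sum>s\<in>I. \<Sum>t\<in>I. \<Sum>u\<in>I. \<Sum>v\<in>I. (if k s t u v then y s t * y u v else 0 :: real)"
  let ?D = "\<Sum>s\<in>I. (\<Sum>t\<in>I. y s t)\<^sup>2"
  have "(\<Sum>s\<in>I. \<Sum>t\<in>I. y s t)\<^sup>2 = (\<Sum>s\<in>I. \<Sum>t\<in>I. \<Sum>u\<in>I. \<Sum>v\<in>I. y s t * y u v)"
    unfolding power2_eq_square sum_distrib_right unfolding sum_distrib_left ..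
  \<comment> \<open>Inclusion-exclusion for the four ways in which \<open>{s, t}\<close> and \<open>{u, v}\<close> can meet when \<open>s \<noteq> t\<close> and \<open>u \<noteq> v\<close>.\<close>
  also have "\<dots> = (\<Sum>s\<in>I. \<Sum>t\<in>I. \<Sum>u\<in>I. \<Sum>v\<in>I.
      (if distinct [s,t,u,v] then y s t * y u v else 0) + (if s = u then y s t * y u v else 0)
      + (if s = v then y s t * y u v else 0) + (if t = u then y s t * y u v else 0)
      + (if t = v then y s t * y u v else 0)
      - (if s = u \<and> t = v then y s t * y u v else 0) - (if s = v \<and> t = u then y s t * y u v else 0))"
    proof (intro sum.cong refl)
    fix s t u v
    show "y s t * y u v =
      (if distinct [s,t,u,v] then y s t * y u v else 0) + (if s = u then y s t * y u v else 0)
      + (if s = v then y s t * y u v else 0) + (if t = u then y s t * y u v else 0)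
      + (if t = v then y s t * y u v else 0)
      - (if s = u \<and> t = v then y s t * y u v else 0) - (if s = v \<and> t = u then y s t * y u v else 0)"
      by (cases "s = t"; cases "u = v"; cases "s = u"; cases "s = v"; cases "t = u"; cases "t = v"; simp add: diag)
  qed
  also have "\<dots> = ?T (\<lambda>s t u v. distinct [s,t,u,v]) + ?T (\<lambda>s t u v. s = u) + ?T (\<lambda>s t u v. s = v)
     + ?T (\<lambda>s t u v. t = u) + ?T (\<lambda>s t u v. t = v) - ?T (\<lambda>s t u v. s = u \<and> t = v) - ?T (\<lambda>s t u v. s = v \<and> t = u)"
    by (simp only: sum.distrib sum_subtractf)
  also have "?T (\<lambda>s t u v. distinct [s,t,u,v]) = (\<Sum>(s,t,u,v)\<in>quads I. y s t * y u v)"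
  proof -
    have "?T (\<lambda>s t u v. distinct [s,t,u,v])
        = (\<Sum>(s,t,u,v)\<in>I\<times>I\<times>I\<times>I. if distinct [s,t,u,v] then y s t * y u v else 0)"
      by (simp only: sum.cartesian_product split_def fst_conv snd_conv)
    also have "\<dots> = (\<Sum>(s,t,u,v)\<in>quads I. y s t * y u v)"
      using I by (intro sum.mono_neutral_cong_right) (auto simp: quads_def)
    finally show ?thesis .
  qed
  also have "?T (\<lambda>s t u v. s = u) = ?D"
  proof -
    have "(\<Sum>u\<in>I. \<Sum>v\<in>I. if s = u then y s t * y u v else 0) = (\<Sum>v\<in>I. y s t * y s v)" if "s \<in> I" for s t
    proof -
      have "(\<Sum>u\<in>I. \<Sum>v\<in>I. if s = u then y s t * y u v else 0) = (\<Sum>u\<in>I. if s = u then \<Sum>v\<in>I. y s t * y u v else 0)"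
        by (intro sum.cong refl) auto
      then show ?thesis using that I by simp
    qed
    then show ?thesis by (simp add: power2_eq_square sum_product)
  qed
  also have "?T (\<lambda>s t u v. s = v) = ?D"
  proof -
    have "?T (\<lambda>s t u v. s = v) = (\<Sum>s\<in>I. \<Sum>t\<in>I. \<Sum>u\<in>I. y s t * y u s)"
      using I by (intro sum.cong refl) simp
    then show ?thesis using sym by (simp add: power2_eq_square sum_product)
  qed
  also have "?T (\<lambda>s t u v. t = u) = ?D"
  proof -
    have "(\<Sum>u\<in>I. \<Sum>v\<in>I. if t = u then y s t * y u v else 0) = (\<Sum>v\<in>I. y s t * y t v)" if "t \<in> I" for s t
    proof -
      have "(\<Sum>u\<in>I. \<Sum>v\<in>I. if t = u then y s t * y u v else 0) = (\<Sum>u\<in>I. if t = u then \<Sum>v\<in>I. y s t * y u v else 0)"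
        by (intro sum.cong refl) auto
      then show ?thesis using that I by simp
    qed
    then have "?T (\<lambda>s t u v. t = u) = (\<Sum>t\<in>I. \<Sum>s\<in>I. \<Sum>v\<in>I. y s t * y t v)"
      by (subst sum.swap) simp
    then show ?thesis using sym by (simp add: power2_eq_square sum_product)
  qed
  also have "?T (\<lambda>s t u v. t = v) = ?D"
  proof -
    have "?T (\<lambda>s t u v. t = v) = (\<Sum>s\<in>I. \<Sum>t\<in>I. \<Sum>u\<in>I. y s t * y u t)"
      using I by (intro sum.cong refl) simp
    also have "\<dots> = (\<Sum>t\<in>I. \<Sum>s\<in>I. \<Sum>u\<in>I. y s t * y u t)" by (rule sum.swap)
    finally show ?thesis using sym by (simp add: power2_eq_square sum_product)
  qed
  finally have eq: "(\<Sum>s\<in>I. \<Sum>t\<in>I. y s t)\<^sup>2 = (\<Sum>(s,t,u,v)\<in>quads I. y s t * y u v) + ?D + ?D + ?D + ?D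
      - ?T (\<lambda>s t u v. s = u \<and> t = v) - ?T (\<lambda>s t u v. s = v \<and> t = u)" .
  have "0 \<le> ?T (\<lambda>s t u v. s = u \<and> t = v)" "0 \<le> ?T (\<lambda>s t u v. s = v \<and> t = u)"
    by (intro sum_nonneg; simp add: sym)+
  then show ?thesis using eq by linarith
qed

lemma abs_mult_le_half_squares: "\<bar>x * y\<bar> \<le> (x\<^sup>2 + y\<^sup>2) / 2" for x y :: real
  using zero_le_power2[of "\<bar>x\<bar> - \<bar>y\<bar>"] by (simp add: power2_diff abs_mult)

lemma power4_sum_eq:
  fixes z :: "int \<Rightarrow> real"
  shows "(\<Sum>s\<in>I. z s) ^ 4 = (\<Sum>s\<in>I. \<Sum>t\<in>I. \<Sum>u\<in>I. \<Sum>v\<in>I. z s * z t * z u * z v)"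
proof -
  have "(\<Sum>s\<in>I. z s) ^ 4 = (\<Sum>s\<in>I. \<Sum>t\<in>I. z s * z t) * (\<Sum>s\<in>I. \<Sum>t\<in>I. z s * z t)"
    unfolding sum_product[symmetric] power4_eq_xxxx by (simp only: mult.assoc)
  also have "\<dots> = (\<Sum>s\<in>I. \<Sum>t\<in>I. \<Sum>u\<in>I. \<Sum>v\<in>I. (z s * z t) * (z u * z v))"
    unfolding sum_distrib_right unfolding sum_distrib_left ..
  finally show ?thesis by (simp only: mult.assoc)
qed

text \<open>The square of the sum is \<open>T + Q\<close> with \<open>T\<close> the sum of the mixed products and \<open>Q\<close> the sum of
  squares. By \<open>square_sum_array_le\<close>, \<open>T\<^sup>2\<close> is bounded by the sum over
  distinct indices and by multiples of \<open>Q * (T + Q)\<close> and \<open>Q\<^sup>2\<close>, the first of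
  which is absorbed by the fourth power. So the terms with repeated indices can be bounded without
  any expectation of the form \<open>E (X s\<^sup>2 * X t * X u)\<close>.\<close>

lemma power4_sum_le:
  fixes z :: "int \<Rightarrow> real"
  assumes I: "finite I"
  shows "(\<Sum>s\<in>I. z s) ^ 4 \<le> 4 * (\<Sum>(s,t,u,v)\<in>quads I. z s * z t * z u * z v) + 292 * (\<Sum>s\<in>I. (z s)\<^sup>2)\<^sup>2"
proof -
  define y where "y s t = (if s = t then 0 else z s * z t)" for s t
  define S where "S = (\<Sum>s\<in>I. z s)"
  define Q where "Q = (\<Sum>s\<in>I. (z s)\<^sup>2)"
  define T where "T = (\<Sum>s\<in>I. \<Sum>t\<in>I. y s t)"
  define D where "D = (\<Sum>(s,t,u,v)\<in>quads I. z s * z t * z u * z v)"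
  have row: "(\<Sum>t\<in>I. y s t) = z s * S - (z s)\<^sup>2" if "s \<in> I" for s
  proof -
    have "(\<Sum>t\<in>I. y s t) = (\<Sum>t\<in>I. z s * z t - (if s = t then z s * z t else 0))"
      by (rule sum.cong) (auto simp: y_def)
    also have "\<dots> = z s * S - (z s)\<^sup>2"
      using I that by (simp add: sum_subtractf S_def sum_distrib_left power2_eq_square)
    finally show ?thesis .
  qed
  have T: "T = S\<^sup>2 - Q"
    by (simp add: T_def row Q_def sum_subtractf power2_eq_square S_def sum_distrib_right)
  have Q0: "0 \<le> Q" unfolding Q_def by (intro sum_nonneg) auto
  have z4: "(\<Sum>s\<in>I. (z s) ^ 4) \<le> Q\<^sup>2"
  proof -
    have "(\<Sum>s\<in>I. (z s) ^ 4) \<le> (\<Sum>s\<in>I. (z s)\<^sup>2 * Q)"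
    proof (rule sum_mono)
      fix s assume "s \<in> I"
      then have "(z s)\<^sup>2 \<le> Q" unfolding Q_def by (intro member_le_sum I) auto
      then have "(z s)\<^sup>2 * (z s)\<^sup>2 \<le> (z s)\<^sup>2 * Q" by (intro mult_left_mono) auto
      then show "(z s) ^ 4 \<le> (z s)\<^sup>2 * Q" by (simp add: power2_eq_square power4_eq_xxxx mult.assoc)
    qed
    also have "\<dots> = Q\<^sup>2" by (simp add: Q_def power2_eq_square sum_distrib_right)
    finally show ?thesis .
  qed
  have "T\<^sup>2 \<le> (\<Sum>(s,t,u,v)\<in>quads I. y s t * y u v) + 4 * (\<Sum>s\<in>I. (\<Sum>t\<in>I. y s t)\<^sup>2)"
    unfolding T_def by (rule square_sum_array_le[OF I]) (auto simp: y_def)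
  also have "(\<Sum>(s,t,u,v)\<in>quads I. y s t * y u v) = D"
    unfolding D_def by (rule sum.cong) (auto simp: quads_def y_def)
  also have "(\<Sum>s\<in>I. (\<Sum>t\<in>I. y s t)\<^sup>2) \<le> (\<Sum>s\<in>I. 2 * (z s)\<^sup>2 * S\<^sup>2 + 2 * (z s) ^ 4)"
  proof (rule sum_mono)
    fix s assume s: "s \<in> I"
    have "(z s * S - (z s)\<^sup>2)\<^sup>2 \<le> 2 * (z s)\<^sup>2 * S\<^sup>2 + 2 * (z s) ^ 4"
      using zero_le_power2[of "z s * S + (z s)\<^sup>2"] by (simp add: power2_eq_square power4_eq_xxxx algebra_simps)
    then show "(\<Sum>t\<in>I. y s t)\<^sup>2 \<le> 2 * (z s)\<^sup>2 * S\<^sup>2 + 2 * (z s) ^ 4" by (simp add: row[OF s])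
  qed
  also have "\<dots> = 2 * Q * S\<^sup>2 + 2 * (\<Sum>s\<in>I. (z s) ^ 4)"
    by (simp add: sum.distrib Q_def sum_distrib_left sum_distrib_right mult.assoc)
  finally have T2: "T\<^sup>2 \<le> D + 8 * (Q * S\<^sup>2) + 8 * Q\<^sup>2" using z4 by simp
  have "S ^ 4 = (T + Q)\<^sup>2" by (simp add: T power2_eq_square power4_eq_xxxx)
  also have "\<dots> \<le> 2 * T\<^sup>2 + 2 * Q\<^sup>2"
    using zero_le_power2[of "T - Q"] by (simp add: power2_eq_square algebra_simps)
  finally have 1: "S ^ 4 \<le> 2 * D + 16 * (Q * S\<^sup>2) + 18 * Q\<^sup>2" using T2 by simp
  \<comment> \<open>Absorption: half of the fourth power pays for the product with \<open>Q\<close>.\<close>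
  have "16 * (Q * S\<^sup>2) \<le> S ^ 4 / 2 + 128 * Q\<^sup>2"
    using zero_le_power2[of "S\<^sup>2 - 16 * Q"] by (simp add: power2_eq_square power4_eq_xxxx algebra_simps)
  then show ?thesis using 1 unfolding S_def[symmetric] Q_def[symmetric] D_def[symmetric] by linarith
qed

section \<open>Moments of linear combinations\<close>

context prob_space begin

lemma expectation_square_sum_array_le:
  fixes y :: "int \<Rightarrow> int \<Rightarrow> 'a \<Rightarrow> real"
  assumes I: "finite I" and int: "\<And>s t u v. integrable M (\<lambda>\<omega>. y s t \<omega> * y u v \<omega>)"
    and sym: "\<And>s t \<omega>. y s t \<omega> = y t s \<omega>" and diag: "\<And>s \<omega>. y s s \<omega> = 0"
  shows "expectation (\<lambda>\<omega>. (\<Sum>s\<in>I. \<Sum>t\<in>I. y s t \<omega>)\<^sup>2)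
    \<le> (\<Sum>(s,t,u,v)\<in>quads I. \<bar>expectation (\<lambda>\<omega>. y s t \<omega> * y u v \<omega>)\<bar>)
      + 4 * (\<Sum>s\<in>I. expectation (\<lambda>\<omega>. (\<Sum>t\<in>I. y s t \<omega>)\<^sup>2))"
proof -
  have i1: "integrable M (\<lambda>\<omega>. (\<Sum>s\<in>I. \<Sum>t\<in>I. y s t \<omega>)\<^sup>2)"
    unfolding power2_eq_square sum_distrib_right unfolding sum_distrib_left by (intro Bochner_Integration.integrable_sum int)
  have i2: "integrable M (\<lambda>\<omega>. (\<Sum>t\<in>I. y s t \<omega>)\<^sup>2)" for s
    unfolding power2_eq_square sum_product by (intro Bochner_Integration.integrable_sum int)
  have i3: "integrable M (\<lambda>\<omega>. case x of (s,t,u,v) \<Rightarrow> y s t \<omega> * y u v \<omega>)" for x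
    by (cases x) (simp add: int)
  have "expectation (\<lambda>\<omega>. (\<Sum>s\<in>I. \<Sum>t\<in>I. y s t \<omega>)\<^sup>2)
     \<le> expectation (\<lambda>\<omega>. (\<Sum>(s,t,u,v)\<in>quads I. y s t \<omega> * y u v \<omega>) + 4 * (\<Sum>s\<in>I. (\<Sum>t\<in>I. y s t \<omega>)\<^sup>2))"
    using i1 i2 i3 by (intro integral_mono square_sum_array_le I sym diag) auto
  also have "\<dots> = (\<Sum>x\<in>quads I. expectation (\<lambda>\<omega>. case x of (s,t,u,v) \<Rightarrow> y s t \<omega> * y u v \<omega>))
      + 4 * (\<Sum>s\<in>I. expectation (\<lambda>\<omega>. (\<Sum>t\<in>I. y s t \<omega>)\<^sup>2))"
    using i2 i3 by simp
  also have "(\<Sum>x\<in>quads I. expectation (\<lambda>\<omega>. case x of (s,t,u,v) \<Rightarrow> y s t \<omega> * y u v \<omega>))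
     \<le> (\<Sum>(s,t,u,v)\<in>quads I. \<bar>expectation (\<lambda>\<omega>. y s t \<omega> * y u v \<omega>)\<bar>)"
    by (intro sum_mono) (auto split: prod.splits)
  finally show ?thesis by simp
qed

end

text \<open>The moment hypotheses are separated from the dependence hypotheses, because integrability of
  products is needed to turn covariances of products into the expectations in which the latter are
  phrased below.\<close>

locale bounded_fourth_moments = prob_space M for M :: "'a measure" +
  fixes X :: "int \<Rightarrow> 'a \<Rightarrow> real" and P0 :: real
  assumes X_meas [measurable]: "\<And>t. X t \<in> borel_measurable M"
    and X4_integrable: "\<And>t. integrable M (\<lambda>\<omega>. X t \<omega> ^ 4)"
    and X4_le: "\<And>t. expectation (\<lambda>\<omega>. X t \<omega> ^ 4) \<le> P0"
    and X2_le: "\<And>t. expectation (\<lambda>\<omega>. (X t \<omega>)\<^sup>2) \<le> 1"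
begin

lemma X2_integrable: "integrable M (\<lambda>\<omega>. (X t \<omega>)\<^sup>2)"
proof (rule Bochner_Integration.integrable_bound)
  show "integrable M (\<lambda>\<omega>. 1 + X t \<omega> ^ 4)" using X4_integrable by simp
  have "x\<^sup>2 \<le> 1 + x ^ 4" for x :: real
    using zero_le_power2[of "x\<^sup>2 - 1"] zero_le_power2[of "x\<^sup>2"] by (simp add: power2_eq_square power4_eq_xxxx algebra_simps)
  then show "AE \<omega> in M. norm ((X t \<omega>)\<^sup>2) \<le> norm (1 + X t \<omega> ^ 4)" 
    by (intro AE_I2) (smt (verit) real_norm_def zero_le_power2)
qed simp

lemma prod2_integrable: "integrable M (\<lambda>\<omega>. X s \<omega> * X t \<omega>)"
proof (rule Bochner_Integration.integrable_bound)
  show "integrable M (\<lambda>\<omega>. (X s \<omega>)\<^sup>2 + (X t \<omega>)\<^sup>2)" using X2_integrable by simp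
  have "\<bar>x * y\<bar> \<le> x\<^sup>2 + y\<^sup>2" for x y :: real
  proof -
    have "(x\<^sup>2 + y\<^sup>2) / 2 \<le> x\<^sup>2 + y\<^sup>2" by (simp add: field_simps)
    then show ?thesis by (rule order_trans[OF abs_mult_le_half_squares])
  qed
  then show "AE \<omega> in M. norm (X s \<omega> * X t \<omega>) \<le> norm ((X s \<omega>)\<^sup>2 + (X t \<omega>)\<^sup>2)"
    by (intro AE_I2) (smt (verit) real_norm_def)
qed simp

lemma square2_integrable: "integrable M (\<lambda>\<omega>. (X s \<omega>)\<^sup>2 * (X t \<omega>)\<^sup>2)"
  and square2_le: "expectation (\<lambda>\<omega>. (X s \<omega>)\<^sup>2 * (X t \<omega>)\<^sup>2) \<le> P0"
proof -
  have le: "(X s \<omega>)\<^sup>2 * (X t \<omega>)\<^sup>2 \<le> (X s \<omega> ^ 4 + X t \<omega> ^ 4) / 2" for \<omega>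
    using zero_le_power2[of "(X s \<omega>)\<^sup>2 - (X t \<omega>)\<^sup>2"] by (simp add: power2_eq_square power4_eq_xxxx algebra_simps)
  show i: "integrable M (\<lambda>\<omega>. (X s \<omega>)\<^sup>2 * (X t \<omega>)\<^sup>2)"
  proof (rule Bochner_Integration.integrable_bound)
    show "integrable M (\<lambda>\<omega>. (X s \<omega> ^ 4 + X t \<omega> ^ 4) / 2)" using X4_integrable by simp
    show "AE \<omega> in M. norm ((X s \<omega>)\<^sup>2 * (X t \<omega>)\<^sup>2) \<le> norm ((X s \<omega> ^ 4 + X t \<omega> ^ 4) / 2)"
      using le by (intro AE_I2) (smt (verit) real_norm_def mult_nonneg_nonneg zero_le_power2)
  qed simp
  have "expectation (\<lambda>\<omega>. (X s \<omega>)\<^sup>2 * (X t \<omega>)\<^sup>2) \<le> expectation (\<lambda>\<omega>. (X s \<omega> ^ 4 + X t \<omega> ^ 4) / 2)"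
    using X4_integrable by (intro integral_mono i le) simp
  also have "\<dots> \<le> P0" using X4_integrable X4_le[of s] X4_le[of t] by simp
  finally show "expectation (\<lambda>\<omega>. (X s \<omega>)\<^sup>2 * (X t \<omega>)\<^sup>2) \<le> P0" .
qed

lemma prod4_integrable: "integrable M (\<lambda>\<omega>. X s \<omega> * X t \<omega> * X u \<omega> * X v \<omega>)"
proof (rule Bochner_Integration.integrable_bound)
  show "integrable M (\<lambda>\<omega>. (X s \<omega>)\<^sup>2 * (X t \<omega>)\<^sup>2 + (X u \<omega>)\<^sup>2 * (X v \<omega>)\<^sup>2)" using square2_integrable by simp
  have "\<bar>x * y\<bar> \<le> x\<^sup>2 + y\<^sup>2" for x y :: real
  proof -
    have "(x\<^sup>2 + y\<^sup>2) / 2 \<le> x\<^sup>2 + y\<^sup>2" by (simp add: field_simps)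
    then show ?thesis by (rule order_trans[OF abs_mult_le_half_squares])
  qed
  from this[of "a * b" "c * d" for a b c d]
  have "\<bar>a * b * c * d\<bar> \<le> a\<^sup>2 * b\<^sup>2 + c\<^sup>2 * d\<^sup>2" for a b c d :: real by (simp add: mult.assoc power_mult_distrib)
  then show "AE \<omega> in M. norm (X s \<omega> * X t \<omega> * X u \<omega> * X v \<omega>) \<le> norm ((X s \<omega>)\<^sup>2 * (X t \<omega>)\<^sup>2 + (X u \<omega>)\<^sup>2 * (X v \<omega>)\<^sup>2)"
    by (intro AE_I2) (smt (verit) real_norm_def)
qed simp

lemma prod2_le_1: "\<bar>expectation (\<lambda>\<omega>. X s \<omega> * X t \<omega>)\<bar> \<le> 1"
proof -
  have "expectation (\<lambda>\<omega>. \<bar>X s \<omega> * X t \<omega>\<bar>) \<le> expectation (\<lambda>\<omega>. ((X s \<omega>)\<^sup>2 + (X t \<omega>)\<^sup>2) / 2)"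
    using prod2_integrable X2_integrable by (intro integral_mono abs_mult_le_half_squares) auto
  also have "\<dots> \<le> 1" using X2_integrable X2_le[of s] X2_le[of t] by simp
  finally show ?thesis using integral_abs_bound[of M "\<lambda>\<omega>. X s \<omega> * X t \<omega>"] by linarith
qed

lemma P0_nonneg: "0 \<le> P0"
proof -
  have "0 \<le> expectation (\<lambda>\<omega>. X 0 \<omega> ^ 4)" by simp
  then show ?thesis using X4_le[of 0] by linarith
qed

end

text \<open>For a centred series the covariance of \<open>X i\<close> and \<open>X j * X k * X l\<close> is the expectation of the
  product, so the first and second gap conditions bound the same expectation. \<open>P0\<close> and \<open>P1\<close> are
  upper bounds of \<open>\<Phi>\<^sub>0\<close> and \<open>\<Phi>\<^sub>1\<close>.\<close>

locale weakly_dependent_series = bounded_fourth_moments +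
  fixes \<phi> :: "nat \<Rightarrow> real" and P1 :: real
  assumes phi_nonneg: "\<And>k. 1 \<le> k \<Longrightarrow> 0 \<le> \<phi> k"
    and phi_antimono: "\<And>k l. 1 \<le> k \<Longrightarrow> k \<le> l \<Longrightarrow> \<phi> l \<le> \<phi> k"
    and phi_sum_le: "\<And>N. (\<Sum>k<N. real (Suc k) * \<phi> (Suc k)) \<le> P1"
    and left_gap: "\<And>i j k l. i < j \<Longrightarrow> j < k \<Longrightarrow> k < l \<Longrightarrow>
      \<bar>expectation (\<lambda>\<omega>. X i \<omega> * X j \<omega> * X k \<omega> * X l \<omega>)\<bar> \<le> \<phi> (nat (j - i))"
    and right_gap: "\<And>i j k l. i < j \<Longrightarrow> j < k \<Longrightarrow> k < l \<Longrightarrow>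
      \<bar>expectation (\<lambda>\<omega>. X i \<omega> * X j \<omega> * X k \<omega> * X l \<omega>)\<bar> \<le> \<phi> (nat (l - k))"
    and middle_gap: "\<And>i j k l. i < j \<Longrightarrow> j < k \<Longrightarrow> k < l \<Longrightarrow>
      \<bar>expectation (\<lambda>\<omega>. X i \<omega> * X j \<omega> * X k \<omega> * X l \<omega>)
        - expectation (\<lambda>\<omega>. X i \<omega> * X j \<omega>) * expectation (\<lambda>\<omega>. X k \<omega> * X l \<omega>)\<bar> \<le> \<phi> (nat (k - j))"
    and pair_gap: "\<And>i j. i < j \<Longrightarrow> \<bar>expectation (\<lambda>\<omega>. X i \<omega> * X j \<omega>)\<bar> \<le> \<phi> (nat (j - i))"
begin

lemma P1_nonneg: "0 \<le> P1" using phi_sum_le[of 0] by simp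

lemma lag_bound_nonneg: "0 \<le> lag_bound \<phi> y z"
  unfolding lag_bound_def using phi_nonneg by auto

text \<open>Both outer gaps bound the same expectation, so the better of the two bounds holds.\<close>

lemma prod4_le_lag_bound:
  assumes "i < j" "j < k" "k < l"
  shows "\<bar>expectation (\<lambda>\<omega>. X i \<omega> * X j \<omega> * X k \<omega> * X l \<omega>)\<bar> \<le> lag_bound \<phi> (j - i) (l - k)"
  using left_gap[OF assms] right_gap[OF assms] assms by (auto simp: lag_bound_def max_def)

text \<open>A moment inequality of Khinchine type. After \<open>power4_sum_le\<close>, by symmetry, only ordered indices
  \<open>s < t < u < v\<close> matter. Their expectation is bounded through the gaps \<open>t - s\<close> and \<open>v - u\<close>, and
  \<open>2 * \<bar>w s * w t * w u * w v\<bar> \<le> (w s * w u)\<^sup>2 + (w t * w v)\<^sup>2\<close> leaves one free index in each of the two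
  gaps.\<close>

lemma fourth_moment_le:
  fixes w :: "int \<Rightarrow> real"
  assumes I: "finite I"
  shows "expectation (\<lambda>\<omega>. (\<Sum>s\<in>I. w s * X s \<omega>) ^ 4) \<le> 800 * (P0 + P1) * (\<Sum>s\<in>I. (w s)\<^sup>2)\<^sup>2"
proof -
  define W where "W = (\<Sum>s\<in>I. (w s)\<^sup>2)"
  let ?E = "\<lambda>s t u v. expectation (\<lambda>\<omega>. X s \<omega> * X t \<omega> * X u \<omega> * X v \<omega>)"
  define F where "F s t u v = \<bar>w s * w t * w u * w v * ?E s t u v\<bar>" for s t u v
  define g where "g s t u v = \<bar>w s * w t * w u * w v\<bar> * lag_bound \<phi> (t - s) (v - u)" for s t u v
  have gnn: "0 \<le> g s t u v" for s t u v unfolding g_def using lag_bound_nonneg by simp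
  note wit = sum.reindex_bij_witness
  \<comment> \<open>For fixed \<open>s\<close> and \<open>u\<close> the indices \<open>t\<close> and \<open>v\<close> run over the two gaps.\<close>
  have half: "(\<Sum>(s,t,u,v)\<in>quads I. (w s)\<^sup>2 * (w u)\<^sup>2 * lag_bound \<phi> (t - s) (v - u)) \<le> W\<^sup>2 * (8 * P1)"
  proof -
    have inj: "inj_on (\<lambda>(s,t,u,v). ((s,u),(t,v))) (quads I)" by (auto simp: inj_on_def)
    have "(\<Sum>(s,t,u,v)\<in>quads I. (w s)\<^sup>2 * (w u)\<^sup>2 * lag_bound \<phi> (t - s) (v - u))
       = (\<Sum>(p,r)\<in>(\<lambda>(s,t,u,v). ((s,u),(t,v))) ` quads I.
           (w (fst p))\<^sup>2 * (w (snd p))\<^sup>2 * lag_bound \<phi> (fst r - fst p) (snd r - snd p))"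
      by (subst sum.reindex[OF inj]) (auto simp: split_def)
    also have "\<dots> \<le> (\<Sum>(p,r)\<in>(I \<times> I) \<times> (I \<times> I).
           (w (fst p))\<^sup>2 * (w (snd p))\<^sup>2 * lag_bound \<phi> (fst r - fst p) (snd r - snd p))"
      using I lag_bound_nonneg by (intro sum_mono2) (auto simp: quads_def)
    also have "\<dots> = (\<Sum>p\<in>I \<times> I. (w (fst p))\<^sup>2 * (w (snd p))\<^sup>2 *
          (\<Sum>r\<in>I \<times> I. lag_bound \<phi> (fst r - fst p) (snd r - snd p)))"
      by (simp add: sum.cartesian_product[symmetric, of _ "I \<times> I" "I \<times> I"] sum_distrib_left)
    also have "\<dots> \<le> (\<Sum>p\<in>I \<times> I. (w (fst p))\<^sup>2 * (w (snd p))\<^sup>2 * (8 * P1))"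
      by (intro sum_mono mult_left_mono sum_lag_bound_le phi_nonneg phi_sum_le) (use I in \<open>auto simp: inj_on_def prod_eq_iff\<close>)
    also have "\<dots> = W\<^sup>2 * (8 * P1)"
    proof -
      have "W\<^sup>2 = (\<Sum>p\<in>I \<times> I. (w (fst p))\<^sup>2 * (w (snd p))\<^sup>2)"
        unfolding W_def power2_eq_square[of "sum _ _"] sum_product sum.cartesian_product split_def ..
      then show ?thesis by (simp only: sum_distrib_right)
    qed
    finally show ?thesis .
  qed
  have half': "(\<Sum>(s,t,u,v)\<in>quads I. (w t)\<^sup>2 * (w v)\<^sup>2 * lag_bound \<phi> (t - s) (v - u)) \<le> W\<^sup>2 * (8 * P1)"
  proof -
    have "(\<Sum>(s,t,u,v)\<in>quads I. (w t)\<^sup>2 * (w v)\<^sup>2 * lag_bound \<phi> (t - s) (v - u))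
      = (\<Sum>(s,t,u,v)\<in>quads I. (w s)\<^sup>2 * (w u)\<^sup>2 * lag_bound \<phi> (t - s) (v - u))"
      by (rule wit[where i="\<lambda>(s,t,u,v). (t,s,v,u)" and j="\<lambda>(s,t,u,v). (t,s,v,u)"])
         (auto simp: quads_def lag_bound_def abs_minus_commute)
    then show ?thesis using half by simp
  qed
  have G: "(\<Sum>(s,t,u,v)\<in>quads I. g s t u v) \<le> W\<^sup>2 * (8 * P1)"
  proof -
    have "g s t u v \<le> ((w s)\<^sup>2 * (w u)\<^sup>2 * lag_bound \<phi> (t - s) (v - u) + (w t)\<^sup>2 * (w v)\<^sup>2 * lag_bound \<phi> (t - s) (v - u)) / 2"
      for s t u v
    proof -
      from abs_mult_le_half_squares[of "w s * w u" "w t * w v"]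
      have "\<bar>w s * w t * w u * w v\<bar> \<le> ((w s)\<^sup>2 * (w u)\<^sup>2 + (w t)\<^sup>2 * (w v)\<^sup>2) / 2"
        by (simp add: power_mult_distrib mult_ac)
      from mult_right_mono[OF this lag_bound_nonneg[of "t - s" "v - u"]] show ?thesis
        unfolding g_def by (simp add: algebra_simps add_divide_distrib)
    qed
    then have "(\<Sum>(s,t,u,v)\<in>quads I. g s t u v) \<le> (\<Sum>(s,t,u,v)\<in>quads I.
       ((w s)\<^sup>2 * (w u)\<^sup>2 * lag_bound \<phi> (t - s) (v - u) + (w t)\<^sup>2 * (w v)\<^sup>2 * lag_bound \<phi> (t - s) (v - u)) / 2)"
      by (intro sum_mono) (auto simp: split_def)
    also have "\<dots> = ((\<Sum>(s,t,u,v)\<in>quads I. (w s)\<^sup>2 * (w u)\<^sup>2 * lag_bound \<phi> (t - s) (v - u))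
       + (\<Sum>(s,t,u,v)\<in>quads I. (w t)\<^sup>2 * (w v)\<^sup>2 * lag_bound \<phi> (t - s) (v - u))) / 2"
      by (simp add: split_def sum.distrib sum_divide_distrib[symmetric])
    also have "\<dots> \<le> (W\<^sup>2 * (8 * P1) + W\<^sup>2 * (8 * P1)) / 2"
      by (intro divide_right_mono add_mono half half') simp
    finally show ?thesis by (simp add: mult_ac)
  qed
  have G2: "(\<Sum>(s,t,u,v)\<in>quads I. g s u t v) = (\<Sum>(s,t,u,v)\<in>quads I. g s t u v)"
    by (rule wit[where i="\<lambda>(s,t,u,v). (s,u,t,v)" and j="\<lambda>(s,t,u,v). (s,u,t,v)"]) (auto simp: quads_def)
  have G3: "(\<Sum>(s,t,u,v)\<in>quads I. g s u v t) = (\<Sum>(s,t,u,v)\<in>quads I. g s t u v)"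
    by (rule wit[where i="\<lambda>(s,t,u,v). (s,v,t,u)" and j="\<lambda>(s,t,u,v). (s,u,v,t)"]) (auto simp: quads_def)
  have "(\<Sum>(s,t,u,v)\<in>quads I. F s t u v) \<le> 8 * (\<Sum>(s,t,u,v)\<in>quads I. g s t u v + g s u t v + g s u v t)"
  proof (rule sum_quads_le)
    fix s t u v :: int
    show "F t s u v = F s t u v" "F u v s t = F s t u v" by (simp_all add: F_def mult_ac)
    show "0 \<le> g s t u v + g s u t v + g s u v t" using gnn by (simp add: add_nonneg_nonneg)
    have *: "F a b c d \<le> g a b c d" if "a < b" "b < c" "c < d" for a b c d
      unfolding F_def g_def abs_mult[of _ "?E a b c d"] by (intro mult_left_mono prod4_le_lag_bound that) auto
    have F: "F s u t v = F s t u v" "F s u v t = F s t u v" by (simp_all add: F_def mult_ac)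
    assume "s < t" "u < v" "s < u" "distinct [s,t,u,v]"
    then consider "t < u" | "u < t" "t < v" | "u < t" "v < t" by force
    then show "F s t u v \<le> g s t u v + g s u t v + g s u v t"
    proof cases
      case 1 then show ?thesis using *[of s t u v] gnn[of s u t v] gnn[of s u v t] \<open>s < t\<close> \<open>u < v\<close> by simp
    next
      case 2 then show ?thesis using *[of s u t v] gnn[of s t u v] gnn[of s u v t] \<open>s < u\<close> F by simp
    next
      case 3 then show ?thesis using *[of s u v t] gnn[of s t u v] gnn[of s u t v] \<open>s < u\<close> \<open>u < v\<close> F by simp
    qed
  qed
  also have "(\<Sum>(s,t,u,v)\<in>quads I. g s t u v + g s u t v + g s u v t) = 3 * (\<Sum>(s,t,u,v)\<in>quads I. g s t u v)"
    using G2 G3 by (simp add: split_def sum.distrib)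
  finally have D: "(\<Sum>(s,t,u,v)\<in>quads I. F s t u v) \<le> 192 * (W\<^sup>2 * P1)" using G by simp
  define Z where "Z s \<omega> = w s * X s \<omega>" for s \<omega>
  have Z4: "(\<lambda>\<omega>. Z s \<omega> * Z t \<omega> * Z u \<omega> * Z v \<omega>) = (\<lambda>\<omega>. (w s * w t * w u * w v) * (X s \<omega> * X t \<omega> * X u \<omega> * X v \<omega>))" for s t u v
    by (simp add: Z_def mult_ac fun_eq_iff)
  have i4: "integrable M (\<lambda>\<omega>. Z s \<omega> * Z t \<omega> * Z u \<omega> * Z v \<omega>)" for s t u v
    unfolding Z4 using prod4_integrable by simp
  have i4': "integrable M (\<lambda>\<omega>. case x of (s,t,u,v) \<Rightarrow> Z s \<omega> * Z t \<omega> * Z u \<omega> * Z v \<omega>)" for x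
    by (cases x) (simp add: i4)
  have Q2: "(\<Sum>s\<in>I. (Z s \<omega>)\<^sup>2)\<^sup>2 = (\<Sum>s\<in>I. \<Sum>t\<in>I. (w s)\<^sup>2 * (w t)\<^sup>2 * ((X s \<omega>)\<^sup>2 * (X t \<omega>)\<^sup>2))" for \<omega>
    by (simp add: power2_eq_square[of "sum _ _"] sum_product Z_def power_mult_distrib mult_ac)
  have S4: "integrable M (\<lambda>\<omega>. (\<Sum>s\<in>I. Z s \<omega>) ^ 4)"
    unfolding power4_sum_eq using i4 by simp
  have "expectation (\<lambda>\<omega>. (\<Sum>s\<in>I. Z s \<omega>) ^ 4)
    \<le> expectation (\<lambda>\<omega>. 4 * (\<Sum>(s,t,u,v)\<in>quads I. Z s \<omega> * Z t \<omega> * Z u \<omega> * Z v \<omega>) + 292 * (\<Sum>s\<in>I. (Z s \<omega>)\<^sup>2)\<^sup>2)"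
    using S4 i4' square2_integrable by (intro integral_mono power4_sum_le I) (auto simp: Q2)
  also have "\<dots> = 4 * (\<Sum>x\<in>quads I. expectation (\<lambda>\<omega>. case x of (s,t,u,v) \<Rightarrow> Z s \<omega> * Z t \<omega> * Z u \<omega> * Z v \<omega>))
    + 292 * (\<Sum>s\<in>I. \<Sum>t\<in>I. (w s)\<^sup>2 * (w t)\<^sup>2 * expectation (\<lambda>\<omega>. (X s \<omega>)\<^sup>2 * (X t \<omega>)\<^sup>2))"
    using i4' square2_integrable by (simp add: Q2)
  also have "\<dots> \<le> 4 * (\<Sum>(s,t,u,v)\<in>quads I. F s t u v) + 292 * (\<Sum>s\<in>I. \<Sum>t\<in>I. (w s)\<^sup>2 * (w t)\<^sup>2 * P0)"
  proof (intro add_mono mult_left_mono sum_mono square2_le)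
    fix x assume "x \<in> quads I"
    show "expectation (\<lambda>\<omega>. case x of (s,t,u,v) \<Rightarrow> Z s \<omega> * Z t \<omega> * Z u \<omega> * Z v \<omega>) \<le> (case x of (s,t,u,v) \<Rightarrow> F s t u v)"
      by (cases x) (simp add: Z4 F_def)
  qed auto
  also have "(\<Sum>s\<in>I. \<Sum>t\<in>I. (w s)\<^sup>2 * (w t)\<^sup>2 * P0) = W\<^sup>2 * P0"
    unfolding W_def power2_eq_square[of "sum _ _"] sum_product unfolding sum_distrib_right ..
  finally have "expectation (\<lambda>\<omega>. (\<Sum>s\<in>I. Z s \<omega>) ^ 4) \<le> 768 * (W\<^sup>2 * P1) + 292 * (W\<^sup>2 * P0)" using D by linarith
  also have "\<dots> \<le> 800 * (P0 + P1) * W\<^sup>2" using P0_nonneg P1_nonneg by (simp add: algebra_simps mult_right_mono)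
  finally show ?thesis unfolding Z_def W_def .
qed

end

section \<open>Variance of quadratic forms\<close>

context weakly_dependent_series begin

text \<open>The majorant \<open>b\<close> of the coefficients has to decrease, so that the coefficient at a long lag can be
  replaced by the majorant at a shorter gap inside it. In \<open>h\<close> below, the argument of \<open>\<kappa>\<close> is the gap
  that carries the coefficients and the lag bound takes care of the other two. If the two pairs are
  separated, the covariance is small in every gap, and the two coefficients are split by the
  arithmetic-geometric inequality; if they interlace or are nested, both lags contain the middle gap, and
  the two outer gaps give the decay.

  The summand 1 in \<open>L + 1\<close> avoids the assumption \<open>0 < L\<close>, and costs only \<open>O(1 / n)\<close> after division by
  the square of the sample size. The constant 7200 covers \<open>768 = 8 * 6 * 2 * 8\<close> from the disjoint pairs
  and \<open>4 * 1601\<close> from the pairs that share an index.\<close>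

lemma quadratic_form_variance_le:
  fixes a :: "int \<Rightarrow> int \<Rightarrow> real" and b :: "nat \<Rightarrow> real"
  assumes I: "finite I" and a_sym: "\<And>s t. a s t = a t s" and a_diag: "\<And>s. a s s = 0"
    and a_le: "\<And>s t. s \<noteq> t \<Longrightarrow> \<bar>a s t\<bar> \<le> b (nat \<bar>s - t\<bar>)"
    and b_nonneg: "\<And>k. 1 \<le> k \<Longrightarrow> 0 \<le> b k" and b_antimono: "\<And>k l. 1 \<le> k \<Longrightarrow> k \<le> l \<Longrightarrow> b l \<le> b k"
    and b_sum: "\<And>N. (\<Sum>k<N. (b (Suc k))\<^sup>2) \<le> L"
  shows "expectation (\<lambda>\<omega>. (\<Sum>s\<in>I. \<Sum>t\<in>I. a s t * (X s \<omega> * X t \<omega> - expectation (\<lambda>\<omega>. X s \<omega> * X t \<omega>)))\<^sup>2)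
    \<le> 7200 * (P0 + P1) * real (card I) * (L + 1)"
proof -
  define \<gamma> where "\<gamma> s t = expectation (\<lambda>\<omega>. X s \<omega> * X t \<omega>)" for s t
  let ?E = "\<lambda>s t u v. expectation (\<lambda>\<omega>. X s \<omega> * X t \<omega> * X u \<omega> * X v \<omega>)"
  define y where "y s t \<omega> = a s t * (X s \<omega> * X t \<omega> - \<gamma> s t)" for s t \<omega>
  define \<kappa> where "\<kappa> z = (if z = 0 then 0 else (b (nat \<bar>z\<bar>))\<^sup>2)" for z :: int
  have L: "0 \<le> L" using b_sum[of 0] by simp
  have \<kappa>nn: "0 \<le> \<kappa> z" for z unfolding \<kappa>_def by simp
  have \<kappa>_sum: "(\<Sum>z\<in>J. \<kappa> z) \<le> 2 * L" if "finite J" for J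
    unfolding \<kappa>_def using that b_sum by (intro sum_int_lags_le[where b="\<lambda>k. (b k)\<^sup>2"]) auto
  have \<gamma>_sym: "\<gamma> s t = \<gamma> t s" for s t unfolding \<gamma>_def by (simp add: mult.commute)

  have yy: "y s t \<omega> * y u v \<omega> = a s t * a u v * (X s \<omega> * X t \<omega> * X u \<omega> * X v \<omega> - \<gamma> s t * (X u \<omega> * X v \<omega>)
      - \<gamma> u v * (X s \<omega> * X t \<omega>) + \<gamma> s t * \<gamma> u v)" for s t u v \<omega>
    by (simp add: y_def algebra_simps)
  have yy_int: "integrable M (\<lambda>\<omega>. y s t \<omega> * y u v \<omega>)" for s t u v
    unfolding yy using prod4_integrable prod2_integrable by simp
  have yy_E: "expectation (\<lambda>\<omega>. y s t \<omega> * y u v \<omega>) = a s t * a u v * (?E s t u v - \<gamma> s t * \<gamma> u v)" for s t u v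
    unfolding yy using prod4_integrable prod2_integrable by (simp add: prob_space \<gamma>_def[symmetric])
  define F where "F s t u v = \<bar>a s t * a u v * (?E s t u v - \<gamma> s t * \<gamma> u v)\<bar>" for s t u v
  define h where "h s t u v = \<kappa> (t - s) * lag_bound \<phi> (u - t) (v - u) + \<kappa> (v - u) * lag_bound \<phi> (t - s) (u - t)
     + 2 * (\<kappa> (t - u) * lag_bound \<phi> (u - s) (v - t)) + 2 * (\<kappa> (v - u) * lag_bound \<phi> (u - s) (t - v))" for s t u v

  have quads_sum: "(\<Sum>(s,t,u,v)\<in>quads I. h s t u v) \<le> 6 * (real (card I) * (2 * L) * (8 * P1))"
  proof -
    let ?B = "real (card I) * (2 * L) * (8 * P1)"
    have "(\<Sum>x\<in>quads I. \<kappa> (fst (snd x) - fst x) *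
        lag_bound \<phi> (fst (snd (snd x)) - fst (snd x)) (snd (snd (snd x)) - fst (snd (snd x)))) \<le> ?B"
      by (rule sum_edges_le[where base=fst, OF finite_quads[OF I] I])
         (use \<kappa>nn \<kappa>_sum phi_nonneg phi_sum_le in \<open>auto simp: quads_def inj_on_def\<close>)
    moreover have "(\<Sum>x\<in>quads I. \<kappa> (snd (snd (snd x)) - fst (snd (snd x))) *
        lag_bound \<phi> (fst (snd x) - fst x) (fst (snd (snd x)) - fst (snd x))) \<le> ?B"
      by (rule sum_edges_le[where base=fst, OF finite_quads[OF I] I])
         (use \<kappa>nn \<kappa>_sum phi_nonneg phi_sum_le in \<open>auto simp: quads_def inj_on_def\<close>)
    moreover have "(\<Sum>x\<in>quads I. \<kappa> (fst (snd x) - fst (snd (snd x))) *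
        lag_bound \<phi> (fst (snd (snd x)) - fst x) (snd (snd (snd x)) - fst (snd x))) \<le> ?B"
      by (rule sum_edges_le[where base=fst, OF finite_quads[OF I] I])
         (use \<kappa>nn \<kappa>_sum phi_nonneg phi_sum_le in \<open>auto simp: quads_def inj_on_def\<close>)
    moreover have "(\<Sum>x\<in>quads I. \<kappa> (snd (snd (snd x)) - fst (snd (snd x))) *
        lag_bound \<phi> (fst (snd (snd x)) - fst x) (fst (snd x) - snd (snd (snd x)))) \<le> ?B"
      by (rule sum_edges_le[where base=fst, OF finite_quads[OF I] I])
         (use \<kappa>nn \<kappa>_sum phi_nonneg phi_sum_le in \<open>auto simp: quads_def inj_on_def\<close>)
    ultimately show ?thesis
      by (simp add: h_def split_def sum.distrib sum_distrib_left[symmetric])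
  qed

  have "(\<Sum>(s,t,u,v)\<in>quads I. F s t u v) \<le> 8 * (\<Sum>(s,t,u,v)\<in>quads I. h s t u v)"
  proof (rule sum_quads_le)
    fix s t u v :: int
    show "F t s u v = F s t u v" "F u v s t = F s t u v"
      unfolding F_def using a_sym[of s t] \<gamma>_sym[of s t] by (simp_all add: mult_ac)
    have t: "0 \<le> \<kappa> x * lag_bound \<phi> p q" for x p q using \<kappa>nn lag_bound_nonneg by simp
    show "0 \<le> h s t u v" unfolding h_def by (intro add_nonneg_nonneg t mult_nonneg_nonneg[of 2]) auto
    assume o: "s < t" "u < v" "s < u" and d: "distinct [s,t,u,v]"
    \<comment> \<open>Since variances are at most 1, a product of two covariances is as small as each of them.\<close>
    have \<gamma>_le: "\<bar>\<gamma> s t * \<gamma> u v\<bar> \<le> \<bar>\<gamma> s t\<bar>" "\<bar>\<gamma> s t * \<gamma> u v\<bar> \<le> \<bar>\<gamma> u v\<bar>"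
    proof -
      have "\<bar>\<gamma> s t\<bar> \<le> 1" "\<bar>\<gamma> u v\<bar> \<le> 1" unfolding \<gamma>_def by (rule prod2_le_1)+
      then show "\<bar>\<gamma> s t * \<gamma> u v\<bar> \<le> \<bar>\<gamma> s t\<bar>" "\<bar>\<gamma> s t * \<gamma> u v\<bar> \<le> \<bar>\<gamma> u v\<bar>"
        using mult_right_mono[of "\<bar>\<gamma> s t\<bar>" 1 "\<bar>\<gamma> u v\<bar>"] mult_left_mono[of "\<bar>\<gamma> u v\<bar>" 1 "\<bar>\<gamma> s t\<bar>"] by (simp_all add: abs_mult)
    qed
    have \<gamma>_phi: "\<bar>\<gamma> s t\<bar> \<le> \<phi> (nat (t - s))" "\<bar>\<gamma> u v\<bar> \<le> \<phi> (nat (v - u))"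
      unfolding \<gamma>_def using pair_gap o by auto
    have a1: "\<bar>a s t\<bar> \<le> b (nat (t - s))" and a2: "\<bar>a u v\<bar> \<le> b (nat (v - u))"
      using a_le[of s t] a_le[of u v] o by auto
    have a1_mono: "\<bar>a s t\<bar> \<le> b (nat d)" if "0 < d" "d \<le> t - s" for d
      by (rule order_trans[OF a1 b_antimono]) (use that in auto)
    have a2_mono: "\<bar>a u v\<bar> \<le> b (nat d)" if "0 < d" "d \<le> v - u" for d
      by (rule order_trans[OF a2 b_antimono]) (use that in auto)
    have F: "F s t u v = \<bar>a s t * a u v\<bar> * \<bar>?E s t u v - \<gamma> s t * \<gamma> u v\<bar>" by (simp add: F_def abs_mult)
    have \<gamma>\<gamma>_lag: "\<bar>\<gamma> s t * \<gamma> u v\<bar> \<le> lag_bound \<phi> p q"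
      if "0 < \<bar>p\<bar>" "0 < \<bar>q\<bar>" "\<bar>p\<bar> \<le> t - s" "\<bar>q\<bar> \<le> t - s \<or> \<bar>q\<bar> \<le> v - u" for p q
    proof (cases "\<bar>q\<bar> \<le> \<bar>p\<bar>")
      case True
      then have "\<phi> (nat (t - s)) \<le> lag_bound \<phi> p q"
        using that unfolding lag_bound_def by (auto simp: max_def intro!: phi_antimono)
      then show ?thesis using order_trans[OF \<gamma>_le(1) \<gamma>_phi(1)] order_trans[OF \<gamma>_le(2) \<gamma>_phi(2)] by (auto intro: order_trans)
    next
      case False
      then have "\<phi> (nat (t - s)) \<le> lag_bound \<phi> p q \<or> \<phi> (nat (v - u)) \<le> lag_bound \<phi> p q"
        using that unfolding lag_bound_def by (auto simp: max_def intro!: phi_antimono)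
      then show ?thesis using order_trans[OF \<gamma>_le(1) \<gamma>_phi(1)] order_trans[OF \<gamma>_le(2) \<gamma>_phi(2)] by (auto intro: order_trans)
    qed
    \<comment> \<open>The pairs are separated, interlaced or nested.\<close>
    consider "t < u" | "u < t" "t < v" | "u < t" "v < t" using o d by force
    then show "F s t u v \<le> h s t u v"
    proof cases
      case 1
      have E: "\<bar>?E s t u v\<bar> \<le> \<phi> (nat (t - s))" "\<bar>?E s t u v\<bar> \<le> \<phi> (nat (v - u))"
         "\<bar>?E s t u v - \<gamma> s t * \<gamma> u v\<bar> \<le> \<phi> (nat (u - t))"
        unfolding \<gamma>_def using left_gap[of s t u v] right_gap[of s t u v] middle_gap[of s t u v] o 1 by auto
      have c: "\<bar>?E s t u v - \<gamma> s t * \<gamma> u v\<bar> \<le> 2 * \<phi> (nat (t - s))"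
        "\<bar>?E s t u v - \<gamma> s t * \<gamma> u v\<bar> \<le> 2 * \<phi> (nat (v - u))"
        "\<bar>?E s t u v - \<gamma> s t * \<gamma> u v\<bar> \<le> 2 * \<phi> (nat (u - t))"
      proof -
        note tri = abs_triangle_ineq4[of "?E s t u v" "\<gamma> s t * \<gamma> u v"]
        show "\<bar>?E s t u v - \<gamma> s t * \<gamma> u v\<bar> \<le> 2 * \<phi> (nat (t - s))"
          using order_trans[OF tri add_mono[OF E(1) order_trans[OF \<gamma>_le(1) \<gamma>_phi(1)]]] by simp
        show "\<bar>?E s t u v - \<gamma> s t * \<gamma> u v\<bar> \<le> 2 * \<phi> (nat (v - u))"
          using order_trans[OF tri add_mono[OF E(2) order_trans[OF \<gamma>_le(2) \<gamma>_phi(2)]]] by simp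
        show "\<bar>?E s t u v - \<gamma> s t * \<gamma> u v\<bar> \<le> 2 * \<phi> (nat (u - t))"
          using order_trans[OF E(3), of "2 * \<phi> (nat (u - t))"] phi_nonneg[of "nat (u - t)"] 1 by simp
      qed
      have "lag_bound \<phi> (u - t) (v - u) \<in> {\<phi> (nat (u - t)), \<phi> (nat (v - u))}"
        "lag_bound \<phi> (t - s) (u - t) \<in> {\<phi> (nat (t - s)), \<phi> (nat (u - t))}"
        using 1 o by (simp_all add: lag_bound_def max_def)
      then have c1: "\<bar>?E s t u v - \<gamma> s t * \<gamma> u v\<bar> \<le> 2 * lag_bound \<phi> (u - t) (v - u)"
        and c2: "\<bar>?E s t u v - \<gamma> s t * \<gamma> u v\<bar> \<le> 2 * lag_bound \<phi> (t - s) (u - t)"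
        using c by auto
      have "\<bar>a s t * a u v\<bar> \<le> ((a s t)\<^sup>2 + (a u v)\<^sup>2) / 2" by (rule abs_mult_le_half_squares)
      also have "\<dots> \<le> (\<kappa> (t - s) + \<kappa> (v - u)) / 2"
        unfolding \<kappa>_def using a1 a2 o power_mono[OF a1, of 2] power_mono[OF a2, of 2] by simp
      finally have "F s t u v \<le> (\<kappa> (t - s) + \<kappa> (v - u)) / 2 * \<bar>?E s t u v - \<gamma> s t * \<gamma> u v\<bar>"
        unfolding F by (intro mult_right_mono) auto
      also have "\<dots> = \<kappa> (t - s) * (\<bar>?E s t u v - \<gamma> s t * \<gamma> u v\<bar> / 2) + \<kappa> (v - u) * (\<bar>?E s t u v - \<gamma> s t * \<gamma> u v\<bar> / 2)"
        by (simp add: algebra_simps add_divide_distrib)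
      also have "\<dots> \<le> \<kappa> (t - s) * lag_bound \<phi> (u - t) (v - u) + \<kappa> (v - u) * lag_bound \<phi> (t - s) (u - t)"
        using c1 c2 by (intro add_mono mult_left_mono \<kappa>nn) auto
      also have "\<dots> \<le> h s t u v" unfolding h_def using t by simp
      finally show ?thesis .
    next
      case 2
      have "\<bar>?E s t u v\<bar> \<le> lag_bound \<phi> (u - s) (v - t)"
        using prod4_le_lag_bound[of s u t v] o 2 by (simp add: mult_ac)
      moreover have "\<bar>\<gamma> s t * \<gamma> u v\<bar> \<le> lag_bound \<phi> (u - s) (v - t)"
        by (rule \<gamma>\<gamma>_lag) (use o 2 in auto)
      ultimately have c: "\<bar>?E s t u v - \<gamma> s t * \<gamma> u v\<bar> \<le> 2 * lag_bound \<phi> (u - s) (v - t)" by linarith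
      have "\<bar>a s t * a u v\<bar> \<le> b (nat (t - u)) * b (nat (t - u))"
        unfolding abs_mult by (intro mult_mono a1_mono a2_mono b_nonneg) (use o 2 in auto)
      also have "\<dots> = \<kappa> (t - u)" using 2 by (simp add: \<kappa>_def power2_eq_square)
      finally have "F s t u v \<le> \<kappa> (t - u) * (2 * lag_bound \<phi> (u - s) (v - t))"
        unfolding F using c \<kappa>nn by (intro mult_mono) auto
      also have "\<dots> \<le> h s t u v" unfolding h_def using t by simp
      finally show ?thesis .
    next
      case 3
      have "\<bar>?E s t u v\<bar> \<le> lag_bound \<phi> (u - s) (t - v)"
        using prod4_le_lag_bound[of s u v t] o 3 by (simp add: mult_ac)
      moreover have "\<bar>\<gamma> s t * \<gamma> u v\<bar> \<le> lag_bound \<phi> (u - s) (t - v)"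
        by (rule \<gamma>\<gamma>_lag) (use o 3 in auto)
      ultimately have c: "\<bar>?E s t u v - \<gamma> s t * \<gamma> u v\<bar> \<le> 2 * lag_bound \<phi> (u - s) (t - v)" by linarith
      have "\<bar>a s t * a u v\<bar> \<le> b (nat (v - u)) * b (nat (v - u))"
        unfolding abs_mult by (intro mult_mono a1_mono a2_mono b_nonneg) (use o 3 in auto)
      also have "\<dots> = \<kappa> (v - u)" using o by (simp add: \<kappa>_def power2_eq_square)
      finally have "F s t u v \<le> \<kappa> (v - u) * (2 * lag_bound \<phi> (u - s) (t - v))"
        unfolding F using c \<kappa>nn by (intro mult_mono) auto
      also have "\<dots> \<le> h s t u v" unfolding h_def using t by simp
      finally show ?thesis .
    qed
  qed
  then have D: "(\<Sum>(s,t,u,v)\<in>quads I. F s t u v) \<le> 768 * (real (card I) * L * P1)" using quads_sum by simp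

  \<comment> \<open>The pairs that share the index \<open>s\<close>; the weight \<open>L + 1\<close> balances the fourth moments of \<open>X s\<close> and \<open>U\<close>, of which the second is at most \<open>3200 * (P0 + P1) * L\<^sup>2\<close>, and 1601 exceeds \<open>(1 + 3200) / 2\<close>.\<close>
  have row: "expectation (\<lambda>\<omega>. (\<Sum>t\<in>I. y s t \<omega>)\<^sup>2) \<le> 1601 * ((P0 + P1) * (L + 1))" for s
  proof -
    define U where "U \<omega> = (\<Sum>t\<in>I. a s t * X t \<omega>)" for \<omega>
    have W: "(\<Sum>t\<in>I. (a s t)\<^sup>2) \<le> 2 * L"
    proof -
      have "(\<Sum>t\<in>I. (a s t)\<^sup>2) \<le> (\<Sum>t\<in>I. if s = t then 0 else (b (nat \<bar>s - t\<bar>))\<^sup>2)"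
      proof (intro sum_mono)
        fix t show "(a s t)\<^sup>2 \<le> (if s = t then 0 else (b (nat \<bar>s - t\<bar>))\<^sup>2)"
          using power_mono[OF a_le[of s t], of 2] a_diag by simp
      qed
      also have "\<dots> \<le> 2 * L" using I b_sum by (intro sum_shifted_lags_le[where b="\<lambda>k. (b k)\<^sup>2"]) auto
      finally show ?thesis .
    qed
    have U4: "expectation (\<lambda>\<omega>. U \<omega> ^ 4) \<le> 3200 * (P0 + P1) * L\<^sup>2"
    proof -
      have "expectation (\<lambda>\<omega>. U \<omega> ^ 4) \<le> 800 * (P0 + P1) * (\<Sum>t\<in>I. (a s t)\<^sup>2)\<^sup>2"
        unfolding U_def by (rule fourth_moment_le[OF I])
      also have "\<dots> \<le> 800 * (P0 + P1) * (2 * L)\<^sup>2"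
        using W P0_nonneg P1_nonneg by (intro mult_left_mono power_mono sum_nonneg) auto
      finally show ?thesis by (simp add: algebra_simps)
    qed
    have U4_int: "integrable M (\<lambda>\<omega>. U \<omega> ^ 4)"
    proof -
      have "U \<omega> ^ 4 = (\<Sum>i\<in>I. \<Sum>j\<in>I. \<Sum>k\<in>I. \<Sum>l\<in>I. (a s i * a s j * a s k * a s l) * (X i \<omega> * X j \<omega> * X k \<omega> * X l \<omega>))" for \<omega>
        unfolding U_def power4_sum_eq by (simp only: mult_ac)
      then show ?thesis using prod4_integrable by simp
    qed
    have XU_int: "integrable M (\<lambda>\<omega>. X s \<omega> * U \<omega>)"
    proof -
      have "X s \<omega> * U \<omega> = (\<Sum>t\<in>I. a s t * (X s \<omega> * X t \<omega>))" for \<omega> by (simp add: U_def sum_distrib_left mult_ac)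
      then show ?thesis using prod2_integrable by simp
    qed
    have XU2_int: "integrable M (\<lambda>\<omega>. (X s \<omega> * U \<omega>)\<^sup>2)"
    proof -
      have "(X s \<omega> * U \<omega>)\<^sup>2 = (\<Sum>t\<in>I. \<Sum>u\<in>I. a s t * a s u * (X s \<omega> * X t \<omega> * X s \<omega> * X u \<omega>))" for \<omega>
      proof -
        have "X s \<omega> * U \<omega> = (\<Sum>t\<in>I. a s t * (X s \<omega> * X t \<omega>))" by (simp add: U_def sum_distrib_left mult_ac)
        then have "(X s \<omega> * U \<omega>)\<^sup>2 = (\<Sum>t\<in>I. \<Sum>u\<in>I. (a s t * (X s \<omega> * X t \<omega>)) * (a s u * (X s \<omega> * X u \<omega>)))"
          unfolding power2_eq_square by (simp only: sum_product)
        then show ?thesis by (simp only: mult_ac)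
      qed
      then show ?thesis using prod4_integrable by simp
    qed
    have sum_y: "(\<Sum>t\<in>I. y s t \<omega>) = X s \<omega> * U \<omega> - expectation (\<lambda>\<omega>. X s \<omega> * U \<omega>)" for \<omega>
    proof -
      have "expectation (\<lambda>\<omega>. X s \<omega> * U \<omega>) = expectation (\<lambda>\<omega>. \<Sum>t\<in>I. a s t * (X s \<omega> * X t \<omega>))"
        by (simp add: U_def sum_distrib_left mult_ac)
      also have "\<dots> = (\<Sum>t\<in>I. a s t * \<gamma> s t)" using prod2_integrable by (simp add: \<gamma>_def)
      finally show ?thesis by (simp add: y_def U_def sum_distrib_left sum_subtractf right_diff_distrib mult_ac)
    qed
    have "expectation (\<lambda>\<omega>. (\<Sum>t\<in>I. y s t \<omega>)\<^sup>2) = variance (\<lambda>\<omega>. X s \<omega> * U \<omega>)" unfolding sum_y ..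
    also have "\<dots> \<le> expectation (\<lambda>\<omega>. (X s \<omega> * U \<omega>)\<^sup>2)"
      by (subst variance_eq[OF XU_int XU2_int]) simp
    also have "\<dots> \<le> expectation (\<lambda>\<omega>. ((L + 1) * X s \<omega> ^ 4 + U \<omega> ^ 4 / (L + 1)) / 2)"
    proof (rule integral_mono[OF XU2_int])
      show "integrable M (\<lambda>\<omega>. ((L + 1) * X s \<omega> ^ 4 + U \<omega> ^ 4 / (L + 1)) / 2)" using X4_integrable U4_int by simp
      fix \<omega>
      have "0 \<le> ((L + 1) * (X s \<omega>)\<^sup>2 - (U \<omega>)\<^sup>2)\<^sup>2 / (L + 1)" using L by simp
      then show "(X s \<omega> * U \<omega>)\<^sup>2 \<le> ((L + 1) * X s \<omega> ^ 4 + U \<omega> ^ 4 / (L + 1)) / 2"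
        using L by (simp add: field_simps power2_eq_square power4_eq_xxxx)
    qed
    also have "\<dots> = ((L + 1) * expectation (\<lambda>\<omega>. X s \<omega> ^ 4) + expectation (\<lambda>\<omega>. U \<omega> ^ 4) / (L + 1)) / 2"
      using X4_integrable U4_int by simp
    also have "\<dots> \<le> ((L + 1) * P0 + 3200 * (P0 + P1) * (L + 1)) / 2"
    proof -
      have "expectation (\<lambda>\<omega>. U \<omega> ^ 4) \<le> 3200 * (P0 + P1) * (L + 1)\<^sup>2"
        using P0_nonneg P1_nonneg L by (intro order_trans[OF U4] mult_left_mono power_mono) auto
      then have "expectation (\<lambda>\<omega>. U \<omega> ^ 4) / (L + 1) \<le> 3200 * (P0 + P1) * (L + 1)"
        using L by (simp add: divide_le_eq power2_eq_square mult.assoc)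
      moreover have "(L + 1) * expectation (\<lambda>\<omega>. X s \<omega> ^ 4) \<le> (L + 1) * P0"
        using L X4_le by (intro mult_left_mono) auto
      ultimately show ?thesis by (intro divide_right_mono add_mono) simp_all
    qed
    also have "\<dots> \<le> 1601 * ((P0 + P1) * (L + 1))"
    proof -
      have "0 \<le> P0 * (L + 1)" "0 \<le> P1 * (L + 1)" using P0_nonneg P1_nonneg L by auto
      then show ?thesis by (simp add: algebra_simps)
    qed
    finally show ?thesis .
  qed

  have "expectation (\<lambda>\<omega>. (\<Sum>s\<in>I. \<Sum>t\<in>I. y s t \<omega>)\<^sup>2)
    \<le> (\<Sum>(s,t,u,v)\<in>quads I. \<bar>expectation (\<lambda>\<omega>. y s t \<omega> * y u v \<omega>)\<bar>)
      + 4 * (\<Sum>s\<in>I. expectation (\<lambda>\<omega>. (\<Sum>t\<in>I. y s t \<omega>)\<^sup>2))"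
    by (intro expectation_square_sum_array_le I yy_int)
       (use a_sym \<gamma>_sym a_diag in \<open>auto simp: y_def mult.commute\<close>)
  also have "\<dots> \<le> 768 * (real (card I) * L * P1) + 4 * (\<Sum>s\<in>I. 1601 * ((P0 + P1) * (L + 1)))"
    using D row by (intro add_mono mult_left_mono sum_mono) (auto simp: yy_E F_def)
  also have "\<dots> \<le> 7200 * (P0 + P1) * real (card I) * (L + 1)"
  proof -
    have "real (card I) * L * P1 \<le> real (card I) * (L + 1) * (P0 + P1)"
      using P0_nonneg P1_nonneg L by (intro mult_mono) auto
    moreover have "0 \<le> real (card I) * (L + 1) * (P0 + P1)"
      using P0_nonneg P1_nonneg L by auto
    moreover have "(\<Sum>s\<in>I. 1601 * ((P0 + P1) * (L + 1))) = 1601 * (real (card I) * (L + 1) * (P0 + P1))"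
      by (simp add: mult_ac)
    moreover have "7200 * (P0 + P1) * real (card I) * (L + 1) = 7200 * (real (card I) * (L + 1) * (P0 + P1))"
      by (simp add: mult_ac)
    ultimately show ?thesis by linarith
  qed
  finally show ?thesis unfolding y_def \<gamma>_def .
qed

end

section \<open>Kernel sums and the smoothing bias\<close>

text \<open>An antitone function is compared with the step function that takes on each cell of width
  \<open>1 / m\<close> the value at its right end.\<close>

lemma sum_antimono_le_integral:
  fixes f :: "real \<Rightarrow> real"
  assumes int: "set_integrable lborel {0..} f" and m: "0 < m"
    and nn: "\<And>x. 0 \<le> x \<Longrightarrow> 0 \<le> f x" and anti: "\<And>x y. 0 \<le> x \<Longrightarrow> x \<le> y \<Longrightarrow> f y \<le> f x"
  shows "(\<Sum>k<N. f (real (Suc k) / m)) \<le> m * (LINT x:{0..}|lborel. f x)"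
proof -
  let ?A = "\<lambda>k. {real k / m..<real (Suc k) / m}"
  let ?g = "\<lambda>x. \<Sum>k<N. f (real (Suc k) / m) * indicator (?A k) x"
  have le: "?g x \<le> indicator {0..} x * f x" for x
  proof (cases "0 \<le> x")
    case False
    have "x \<notin> ?A k" for k
    proof
      assume "x \<in> ?A k"
      moreover have "0 \<le> real k / m" using m by simp
      ultimately show False using False by simp
    qed
    then show ?thesis using False by simp
  next
    case True
    let ?j = "nat \<lfloor>m * x\<rfloor>"
    have mem: "x \<in> ?A k \<longleftrightarrow> k = ?j" for k
    proof -
      have "x \<in> ?A k \<longleftrightarrow> real k \<le> m * x \<and> m * x < real k + 1"
        using m by (auto simp: field_simps)
      also have "\<dots> \<longleftrightarrow> \<lfloor>m * x\<rfloor> = int k" by (simp add: floor_eq_iff)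
      also have "\<dots> \<longleftrightarrow> k = ?j" using m True by auto
      finally show ?thesis .
    qed
    have "?g x = (\<Sum>k<N. if k = ?j then f (real (Suc k) / m) else 0)"
      by (intro sum.cong refl) (simp only: indicator_def mem, simp)
    also have "\<dots> \<le> f x"
    proof -
      have "x \<in> ?A ?j" by (simp only: mem)
      then have "x \<le> real (Suc ?j) / m" by (simp only: atLeastLessThan_iff) simp
      then have "f (real (Suc ?j) / m) \<le> f x" using True by (intro anti)
      moreover have "0 \<le> f x" using True by (rule nn)
      ultimately show ?thesis by simp
    qed
    finally show ?thesis using True by simp
  qed
  have ind: "integrable lborel (\<lambda>x. f (real (Suc k) / m) * indicator (?A k) x)" for k
    by (intro integrable_mult_right integrable_real_indicator) (use m in \<open>auto simp: field_simps\<close>)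
  have one: "(LINT x|lborel. f (real (Suc k) / m) * indicator (?A k) x) = f (real (Suc k) / m) / m" for k
    using m by (simp add: divide_right_mono diff_divide_distrib[symmetric])
  have "(\<Sum>k<N. f (real (Suc k) / m)) = m * (LINT x|lborel. ?g x)"
    unfolding Bochner_Integration.integral_sum[OF ind] one sum_distrib_left using m by simp
  also have "\<dots> \<le> m * (LINT x:{0..}|lborel. f x)"
    using m ind le int unfolding set_lebesgue_integral_def set_integrable_def
    by (intro mult_left_mono integral_mono Bochner_Integration.integrable_sum) auto
  finally show ?thesis .
qed

context
  fixes K :: "real \<Rightarrow> real"
  assumes bdd: "bdd_above ((\<lambda>x. \<bar>K x\<bar>) ` {0..})"
begin

lemma bdd_above_kernel_tail: "0 \<le> x \<Longrightarrow> bdd_above ((\<lambda>y. \<bar>K y\<bar>) ` {x..})"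
  by (rule bdd_above_mono[OF bdd]) auto

lemma abs_le_Kbar: "0 \<le> x \<Longrightarrow> x \<le> y \<Longrightarrow> \<bar>K y\<bar> \<le> Kbar K x"
  unfolding Kbar_def by (intro cSUP_upper bdd_above_kernel_tail) auto

lemma Kbar_nonneg: "0 \<le> x \<Longrightarrow> 0 \<le> Kbar K x"
  using abs_le_Kbar[of x x] by linarith

lemma Kbar_antimono: "0 \<le> x \<Longrightarrow> x \<le> y \<Longrightarrow> Kbar K y \<le> Kbar K x"
  unfolding Kbar_def by (intro cSUP_subset_mono bdd_above_kernel_tail) auto

end

lemma sum_Kbar_sq_le:
  assumes K: "kernel_conditions K q kq" and m: "0 < m"
  shows "(\<Sum>k<N. (Kbar K (real (Suc k) / m))\<^sup>2) \<le> m * (LINT x:{0..}|lborel. (Kbar K x)\<^sup>2)"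
proof -
  have bdd: "bdd_above ((\<lambda>x. \<bar>K x\<bar>) ` {0..})" using K by (simp add: kernel_conditions_def)
  show ?thesis
    by (rule sum_antimono_le_integral[OF _ m])
       (use K Kbar_nonneg[OF bdd] Kbar_antimono[OF bdd] in \<open>auto simp: kernel_conditions_def intro!: power_mono\<close>)
qed

text \<open>Near 0 the quotient is close to its limit; away from 0 the kernel and \<open>x powr (- q)\<close> are
  bounded.\<close>

lemma kernel_quotient_bounded:
  assumes K: "kernel_conditions K q kq"
  obtains B where "\<And>x. 0 < x \<Longrightarrow> \<bar>x powr (- q) * (K x - 1)\<bar> \<le> B"
proof -
  have bdd: "bdd_above ((\<lambda>x. \<bar>K x\<bar>) ` {0..})" and q: "0 < q"
    and lim: "((\<lambda>x. x powr (- q) * (K x - 1)) \<longlongrightarrow> kq) (at_right 0)"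
    using K by (auto simp: kernel_conditions_def)
  have "eventually (\<lambda>x. dist (x powr (- q) * (K x - 1)) kq < 1) (at_right 0)"
    using lim by (rule tendstoD) simp
  then obtain d where d: "0 < d" "\<And>x. 0 < x \<Longrightarrow> x < d \<Longrightarrow> dist (x powr (- q) * (K x - 1)) kq < 1"
    unfolding eventually_at_right_field by auto
  show ?thesis
  proof (rule that[of "max (\<bar>kq\<bar> + 1) (d powr (- q) * (Kbar K 0 + 1))"])
    fix x :: real assume x: "0 < x"
    show "\<bar>x powr (- q) * (K x - 1)\<bar> \<le> max (\<bar>kq\<bar> + 1) (d powr (- q) * (Kbar K 0 + 1))"
    proof (cases "x < d")
      case True
      then show ?thesis using d(2)[OF x True] by (simp add: dist_real_def)
    next
      case False
      have "\<bar>K x - 1\<bar> \<le> Kbar K 0 + 1" using abs_le_Kbar[OF bdd, of 0 x] x by simp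
      then have "\<bar>x powr (- q) * (K x - 1)\<bar> \<le> d powr (- q) * (Kbar K 0 + 1)"
        unfolding abs_mult using False d(1) q by (intro mult_mono) (auto intro: powr_mono2')
      then show ?thesis by simp
    qed
  qed
qed

text \<open>Dominated convergence for series: \<open>m powr q * (K (j / m) - 1)\<close> equals \<open>j powr q\<close> times the quotient
  \<open>x powr (- q) * (K x - 1)\<close> at \<open>x = j / m\<close>, and this quotient is bounded.\<close>

lemma kernel_bias_tendsto:
  fixes c :: "nat \<Rightarrow> real"
  assumes K: "kernel_conditions K q kq" and sum: "summable (\<lambda>j. \<bar>real (Suc j) powr q * c j\<bar>)"
  shows "((\<lambda>m. m powr q * (\<Sum>j. (K (real (Suc j) / m) - 1) * c j)) \<longlongrightarrow> kq * (\<Sum>j. real (Suc j) powr q * c j)) at_top"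
proof -
  obtain B where B: "\<And>x. 0 < x \<Longrightarrow> \<bar>x powr (- q) * (K x - 1)\<bar> \<le> B"
    using kernel_quotient_bounded[OF K] by blast
  have eq: "m powr q * ((K (real (Suc j) / m) - 1) * c j)
      = (real (Suc j) / m) powr (- q) * (K (real (Suc j) / m) - 1) * (real (Suc j) powr q * c j)" if "0 < m" for m j
    using that by (simp add: powr_divide powr_minus field_simps del: of_nat_Suc)
  have "((\<lambda>m. \<Sum>j. m powr q * ((K (real (Suc j) / m) - 1) * c j)) \<longlongrightarrow> (\<Sum>j. kq * (real (Suc j) powr q * c j))) at_top"
  proof (rule conjunct2[OF conjunct2[OF tannerys_theorem]])
    fix j
    have "filterlim (\<lambda>m. real (Suc j) / m) (at_right 0) at_top"
      unfolding filterlim_at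
      by (auto intro!: tendsto_divide_0[OF tendsto_const] filterlim_at_top_imp_at_infinity filterlim_ident
            eventually_mono[OF eventually_gt_at_top[of 0]])
    then have "((\<lambda>m. (real (Suc j) / m) powr (- q) * (K (real (Suc j) / m) - 1)) \<longlongrightarrow> kq) at_top"
      using K unfolding kernel_conditions_def by (auto intro: filterlim_compose)
    then have "((\<lambda>m. (real (Suc j) / m) powr (- q) * (K (real (Suc j) / m) - 1) * (real (Suc j) powr q * c j))
       \<longlongrightarrow> kq * (real (Suc j) powr q * c j)) at_top"
      by (intro tendsto_mult tendsto_const)
    then show "((\<lambda>m. m powr q * ((K (real (Suc j) / m) - 1) * c j)) \<longlongrightarrow> kq * (real (Suc j) powr q * c j)) at_top"
      by (rule Lim_transform_eventually) (rule eventually_mono[OF eventually_gt_at_top[of 0] eq[symmetric]])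
  next
    have "norm (m powr q * ((K (real (Suc j) / m) - 1) * c j)) \<le> B * \<bar>real (Suc j) powr q * c j\<bar>" if "0 < m" for m j
      unfolding eq[OF that] real_norm_def abs_mult[of _ "real (Suc j) powr q * c j"]
      using that by (intro mult_right_mono B) auto
    then show "\<forall>\<^sub>F (j, m) in at_top \<times>\<^sub>F at_top. norm (m powr q * ((K (real (Suc j) / m) - 1) * c j)) \<le> B * \<bar>real (Suc j) powr q * c j\<bar>"
      by (intro eventually_mono[OF iffD2[OF eventually_prod2[of at_top "\<lambda>m. 0 < m"] eventually_gt_at_top[of 0]]]) auto
    show "summable (\<lambda>j. B * \<bar>real (Suc j) powr q * c j\<bar>)" using sum by (rule summable_mult)
  qed auto
  moreover have "eventually (\<lambda>m. (\<Sum>j. m powr q * ((K (real (Suc j) / m) - 1) * c j))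
      = m powr q * (\<Sum>j. (K (real (Suc j) / m) - 1) * c j)) at_top"
  proof (rule eventually_mono[OF eventually_gt_at_top[of 0]], rule suminf_mult)
    fix m :: real assume m: "0 < m"
    have bdd: "bdd_above ((\<lambda>x. \<bar>K x\<bar>) ` {0..})" and q: "0 < q" using K by (auto simp: kernel_conditions_def)
    show "summable (\<lambda>j. (K (real (Suc j) / m) - 1) * c j)"
    proof (rule summable_comparison_test'[OF summable_mult[OF sum, of "Kbar K 0 + 1"]])
      fix j
      have "\<bar>K (real (Suc j) / m) - 1\<bar> \<le> Kbar K 0 + 1" using abs_le_Kbar[OF bdd, of 0 "real (Suc j) / m"] m by simp
      moreover have "\<bar>c j\<bar> \<le> \<bar>real (Suc j) powr q * c j\<bar>"
        using mult_right_mono[OF ge_one_powr_ge_zero[of "real (Suc j)" q], of "\<bar>c j\<bar>"] q by (simp add: abs_mult)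
      ultimately show "norm ((K (real (Suc j) / m) - 1) * c j) \<le> (Kbar K 0 + 1) * \<bar>real (Suc j) powr q * c j\<bar>"
        unfolding real_norm_def abs_mult[of "K _ - 1"] by (intro mult_mono) auto
    qed
  qed
  moreover have "(\<Sum>j. kq * (real (Suc j) powr q * c j)) = kq * (\<Sum>j. real (Suc j) powr q * c j)"
    by (rule suminf_mult[OF summable_rabs_cancel[OF sum]])
  ultimately show ?thesis by (simp only: filterlim_cong[OF refl refl])
qed

lemma toeplitz_sum:
  fixes h :: "nat \<Rightarrow> real"
  shows "(\<Sum>s\<in>{1..int n}. \<Sum>t\<in>{1..int n}. h (nat \<bar>s - t\<bar>)) = real n * h 0 + 2 * (\<Sum>j<n. real (n - Suc j) * h (Suc j))"
proof (induction n)
  case (Suc n)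
  have ins: "{1..int (Suc n)} = insert (int (Suc n)) {1..int n}" by auto
  have col: "(\<Sum>t\<in>{1..int n}. h (nat \<bar>t - int (Suc n)\<bar>)) = (\<Sum>j<n. h (Suc j))"
    by (rule sum.reindex_bij_witness[where i="\<lambda>j. int n - int j" and j="\<lambda>t. nat (int n - t)"])
       (auto simp: nat_diff_distrib intro!: arg_cong[of _ _ h])
  then have row: "(\<Sum>t\<in>{1..int n}. h (nat \<bar>int (Suc n) - t\<bar>)) = (\<Sum>j<n. h (Suc j))"
    by (simp only: abs_minus_commute)
  have "(\<Sum>s\<in>{1..int (Suc n)}. \<Sum>t\<in>{1..int (Suc n)}. h (nat \<bar>s - t\<bar>))
    = (\<Sum>s\<in>{1..int n}. \<Sum>t\<in>{1..int n}. h (nat \<bar>s - t\<bar>)) + h 0 + 2 * (\<Sum>j<n. h (Suc j))"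
    unfolding ins using col row by (simp add: sum.distrib)
  also have "\<dots> = real (Suc n) * h 0 + 2 * ((\<Sum>j<n. real (n - Suc j) * h (Suc j)) + (\<Sum>j<n. h (Suc j)))"
    by (simp add: Suc.IH algebra_simps)
  also have "(\<Sum>j<n. real (n - Suc j) * h (Suc j)) + (\<Sum>j<n. h (Suc j)) = (\<Sum>j<Suc n. real (Suc n - Suc j) * h (Suc j))"
    by (simp add: sum.distrib[symmetric]) (intro sum.cong, auto simp: of_nat_diff algebra_simps)
  finally show ?case .
qed simp

text \<open>Replacing the weight \<open>n - j\<close> of the lag \<open>j\<close> by \<open>n\<close> costs \<open>min j n\<close>, which is at most \<open>j\<close>.\<close>

lemma toeplitz_sum_approx:
  fixes h :: "nat \<Rightarrow> real"
  assumes sum: "summable (\<lambda>j. real (Suc j) * \<bar>h (Suc j)\<bar>)"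
  shows "\<bar>(\<Sum>s\<in>{1..int n}. \<Sum>t\<in>{1..int n}. h (nat \<bar>s - t\<bar>)) - real n * (h 0 + 2 * (\<Sum>j. h (Suc j)))\<bar>
    \<le> 2 * (\<Sum>j. real (Suc j) * \<bar>h (Suc j)\<bar>)"
proof -
  have h: "summable (\<lambda>j. h (Suc j))"
  proof (rule summable_comparison_test'[OF sum])
    fix j show "norm (h (Suc j)) \<le> real (Suc j) * \<bar>h (Suc j)\<bar>"
      using mult_right_mono[of 1 "real (Suc j)" "\<bar>h (Suc j)\<bar>"] by simp
  qed
  have fin: "(\<Sum>j<n. real (n - Suc j) * h (Suc j)) = (\<Sum>j. real (n - Suc j) * h (Suc j))"
    "summable (\<lambda>j. real (n - Suc j) * h (Suc j))"
    by (rule suminf_finite[symmetric], simp, simp) (rule summable_finite[of "{..<n}"], simp, simp)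
  have d: "real n * (\<Sum>j. h (Suc j)) - (\<Sum>j. real (n - Suc j) * h (Suc j)) = (\<Sum>j. (real n - real (n - Suc j)) * h (Suc j))"
    by (simp only: left_diff_distrib suminf_diff[OF summable_mult[OF h] fin(2), symmetric] suminf_mult[OF h])
  have le: "norm ((real n - real (n - Suc j)) * h (Suc j)) \<le> real (Suc j) * \<bar>h (Suc j)\<bar>" for j
    unfolding real_norm_def abs_mult by (intro mult_right_mono) auto
  have "\<bar>\<Sum>j. (real n - real (n - Suc j)) * h (Suc j)\<bar> \<le> (\<Sum>j. real (Suc j) * \<bar>h (Suc j)\<bar>)"
    using norm_suminf_le[OF le sum] by simp
  then show ?thesis unfolding toeplitz_sum fin d[symmetric] by (simp add: algebra_simps)
qed

lemma infsum_even_int: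
  fixes h :: "int \<Rightarrow> real"
  assumes even: "\<And>j. h (- j) = h j" and sum: "summable (\<lambda>j. \<bar>h (int (Suc j))\<bar>)"
  shows "infsum h UNIV = h 0 + 2 * (\<Sum>j. h (int (Suc j)))"
proof -
  have n: "((\<lambda>j. h (int (Suc j))) has_sum (\<Sum>j. h (int (Suc j)))) UNIV"
    by (rule norm_summable_imp_has_sum) (use sum summable_sums[OF summable_rabs_cancel[OF sum]] in auto)
  have p: "(h has_sum (\<Sum>j. h (int (Suc j)))) {0<..}"
    by (rule iffD1[OF has_sum_reindex_bij_witness[where i="\<lambda>y. nat y - 1" and j="\<lambda>j. int (Suc j)"] n]) auto
  have m: "(h has_sum (\<Sum>j. h (int (Suc j)))) {..<0}"
    by (rule iffD1[OF has_sum_reindex_bij_witness[where i="\<lambda>y. - y" and j="\<lambda>j. - j"] p]) (auto simp: even)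
  have z: "(h has_sum h 0) {0}" using has_sum_finite[of "{0}" h] by simp
  have "(h has_sum (h 0 + (\<Sum>j. h (int (Suc j))) + (\<Sum>j. h (int (Suc j))))) ({0} \<union> {0<..} \<union> {..<0})"
    by (intro has_sum_Un_disjoint p m z) auto
  moreover have "{0} \<union> {0<..} \<union> {..<0} = (UNIV :: int set)" by auto
  ultimately show ?thesis by (simp add: infsumI)
qed

section \<open>The mean squared error at fixed bandwidth and sample size\<close>

lemma cov_commute: "cov M X Y = cov M Y X"
  by (simp add: cov_def mult.commute)

context prob_space begin

lemma cov_eq_expectation:
  assumes "integrable M X" "integrable M Y" "integrable M (\<lambda>\<omega>. X \<omega> * Y \<omega>)"
  shows "cov M X Y = expectation (\<lambda>\<omega>. X \<omega> * Y \<omega>) - expectation X * expectation Y"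
proof -
  have "cov M X Y = expectation (\<lambda>\<omega>. X \<omega> * Y \<omega> - expectation X * Y \<omega> - expectation Y * X \<omega> + expectation X * expectation Y)"
    unfolding cov_def by (simp add: algebra_simps)
  also have "\<dots> = expectation (\<lambda>\<omega>. X \<omega> * Y \<omega>) - expectation X * expectation Y"
    using assms by (simp add: prob_space)
  finally show ?thesis .
qed

end

context bounded_fourth_moments begin

definition centred_product :: "int \<Rightarrow> int \<Rightarrow> 'a \<Rightarrow> real" where
  "centred_product s t \<omega> = X s \<omega> * X t \<omega> - expectation (\<lambda>\<omega>. X s \<omega> * X t \<omega>)"

lemma centred_product_mult_integrable: "integrable M (\<lambda>\<omega>. centred_product s t \<omega> * centred_product u v \<omega>)"
proof -
  have "centred_product s t \<omega> * centred_product u v \<omega> = X s \<omega> * X t \<omega> * X u \<omega> * X v \<omega>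
      - expectation (\<lambda>\<omega>. X s \<omega> * X t \<omega>) * (X u \<omega> * X v \<omega>)
      - expectation (\<lambda>\<omega>. X u \<omega> * X v \<omega>) * (X s \<omega> * X t \<omega>)
      + expectation (\<lambda>\<omega>. X s \<omega> * X t \<omega>) * expectation (\<lambda>\<omega>. X u \<omega> * X v \<omega>)" for \<omega>
    by (simp add: centred_product_def algebra_simps)
  then show ?thesis using prod4_integrable prod2_integrable by simp
qed

lemma centred_product_integrable: "integrable M (centred_product s t)"
  unfolding centred_product_def[abs_def] using prod2_integrable by simp

lemma expectation_centred_product: "expectation (centred_product s t) = 0"
  unfolding centred_product_def[abs_def] using prod2_integrable by (simp add: prob_space)

lemma centred_form_square_integrable:
  "integrable M (\<lambda>\<omega>. (\<Sum>s\<in>I. \<Sum>t\<in>I. w s t * centred_product s t \<omega>)\<^sup>2)"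
proof -
  have "(\<Sum>s\<in>I. \<Sum>t\<in>I. w s t * centred_product s t \<omega>)\<^sup>2
    = (\<Sum>s\<in>I. \<Sum>t\<in>I. \<Sum>u\<in>I. \<Sum>v\<in>I. (w s t * w u v) * (centred_product s t \<omega> * centred_product u v \<omega>))" for \<omega>
    unfolding power2_eq_square sum_distrib_right unfolding sum_distrib_left by (simp only: mult_ac)
  then show ?thesis using centred_product_mult_integrable by simp
qed

text \<open>Expanding the square gives every covariance of two squares the same coefficient 1, so one-sided
  bounds on these covariances suffice.\<close>

lemma diagonal_variance_le:
  assumes I: "finite I" and psi_nonneg: "\<And>k. 1 \<le> k \<Longrightarrow> 0 \<le> \<psi> k"
    and psi_sum: "\<And>N. (\<Sum>k<N. \<psi> (Suc k)) \<le> P2"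
    and sq: "\<And>s t. s < t \<Longrightarrow> cov M (\<lambda>\<omega>. (X s \<omega>)\<^sup>2) (\<lambda>\<omega>. (X t \<omega>)\<^sup>2) \<le> \<psi> (nat (t - s))"
  shows "expectation (\<lambda>\<omega>. (\<Sum>s\<in>I. centred_product s s \<omega>)\<^sup>2) \<le> real (card I) * (P0 + 2 * P2)"
proof -
  let ?e = "\<lambda>s t. expectation (\<lambda>\<omega>. centred_product s s \<omega> * centred_product t t \<omega>)"
  have e: "?e s t = cov M (\<lambda>\<omega>. (X s \<omega>)\<^sup>2) (\<lambda>\<omega>. (X t \<omega>)\<^sup>2)" for s t
    by (simp add: cov_def centred_product_def power2_eq_square)
  have diag: "?e s s \<le> P0" for s
  proof -
    have "?e s s = expectation (\<lambda>\<omega>. (X s \<omega>)\<^sup>2 * (X s \<omega>)\<^sup>2) - expectation (\<lambda>\<omega>. (X s \<omega>)\<^sup>2) * expectation (\<lambda>\<omega>. (X s \<omega>)\<^sup>2)"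
      unfolding e by (intro cov_eq_expectation X2_integrable square2_integrable)
    then show ?thesis using square2_le[of s s] by simp (smt (verit) zero_le_square)
  qed
  have off: "?e s t \<le> \<psi> (nat \<bar>s - t\<bar>)" if "s \<noteq> t" for s t
  proof (cases "s < t")
    case True then show ?thesis unfolding e using sq[of s t] by simp
  next
    case False then show ?thesis unfolding e using sq[of t s] that cov_commute[of M "\<lambda>\<omega>. (X s \<omega>)\<^sup>2"] by simp
  qed
  have "expectation (\<lambda>\<omega>. (\<Sum>s\<in>I. centred_product s s \<omega>)\<^sup>2) = (\<Sum>s\<in>I. \<Sum>t\<in>I. ?e s t)"
    unfolding power2_eq_square sum_product using centred_product_mult_integrable by simp
  also have "\<dots> \<le> (\<Sum>s\<in>I. \<Sum>t\<in>I. (if s = t then P0 else 0) + (if s = t then 0 else \<psi> (nat \<bar>s - t\<bar>)))"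
    using diag off by (intro sum_mono) auto
  also have "\<dots> \<le> (\<Sum>s\<in>I. P0 + 2 * P2)"
    unfolding sum.distrib using I psi_nonneg psi_sum
    by (intro add_mono sum_mono sum_shifted_lags_le) auto
  finally show ?thesis by simp
qed

end

context weakly_dependent_series begin

lemma estimator_variance_le:
  fixes \<kappa> b \<psi> :: "nat \<Rightarrow> real"
  assumes I: "finite I"
    and kappa_le: "\<And>k. 1 \<le> k \<Longrightarrow> \<bar>\<kappa> k\<bar> \<le> b k" and kappa_0: "\<kappa> 0 = 1"
    and b_antimono: "\<And>k l. 1 \<le> k \<Longrightarrow> k \<le> l \<Longrightarrow> b l \<le> b k" and b_sum: "\<And>N. (\<Sum>k<N. (b (Suc k))\<^sup>2) \<le> L"
    and psi_nonneg: "\<And>k. 1 \<le> k \<Longrightarrow> 0 \<le> \<psi> k" and psi_sum: "\<And>N. (\<Sum>k<N. \<psi> (Suc k)) \<le> P2"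
    and sq: "\<And>s t. s < t \<Longrightarrow> cov M (\<lambda>\<omega>. (X s \<omega>)\<^sup>2) (\<lambda>\<omega>. (X t \<omega>)\<^sup>2) \<le> \<psi> (nat (t - s))"
  shows "expectation (\<lambda>\<omega>. (\<Sum>s\<in>I. \<Sum>t\<in>I. \<kappa> (nat \<bar>s - t\<bar>) * centred_product s t \<omega>)\<^sup>2)
    \<le> real (card I) * (2 * (P0 + 2 * P2) + 14400 * (P0 + P1) * (L + 1))"
proof -
  define a where "a s t = (if s = t then 0 else \<kappa> (nat \<bar>s - t\<bar>))" for s t :: int
  define D where "D \<omega> = (\<Sum>s\<in>I. centred_product s s \<omega>)" for \<omega>
  define T where "T \<omega> = (\<Sum>s\<in>I. \<Sum>t\<in>I. a s t * centred_product s t \<omega>)" for \<omega>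
  have D_int: "integrable M (\<lambda>\<omega>. (D \<omega>)\<^sup>2)"
    unfolding D_def power2_eq_square sum_product using centred_product_mult_integrable by simp
  have T_int: "integrable M (\<lambda>\<omega>. (T \<omega>)\<^sup>2)" unfolding T_def by (rule centred_form_square_integrable)
  have split: "(\<Sum>s\<in>I. \<Sum>t\<in>I. \<kappa> (nat \<bar>s - t\<bar>) * centred_product s t \<omega>) = D \<omega> + T \<omega>" for \<omega>
  proof -
    have "(\<Sum>s\<in>I. \<Sum>t\<in>I. \<kappa> (nat \<bar>s - t\<bar>) * centred_product s t \<omega>)
       = (\<Sum>s\<in>I. \<Sum>t\<in>I. (if s = t then centred_product s t \<omega> else 0) + a s t * centred_product s t \<omega>)"
      by (intro sum.cong refl) (auto simp: a_def kappa_0)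
    then show ?thesis using I by (simp add: D_def T_def sum.distrib)
  qed
  have "expectation (\<lambda>\<omega>. (T \<omega>)\<^sup>2) \<le> 7200 * (P0 + P1) * real (card I) * (L + 1)"
    unfolding T_def centred_product_def
  proof (rule quadratic_form_variance_le[OF I, where b=b])
    show "0 \<le> b k" if "1 \<le> k" for k using kappa_le[OF that] by linarith
  qed (use kappa_le b_antimono b_sum in \<open>auto simp: a_def abs_minus_commute\<close>)
  moreover have "expectation (\<lambda>\<omega>. (D \<omega>)\<^sup>2) \<le> real (card I) * (P0 + 2 * P2)"
    unfolding D_def by (rule diagonal_variance_le[OF I psi_nonneg psi_sum sq])
  moreover have "expectation (\<lambda>\<omega>. (D \<omega> + T \<omega>)\<^sup>2) \<le> expectation (\<lambda>\<omega>. 2 * (D \<omega>)\<^sup>2 + 2 * (T \<omega>)\<^sup>2)"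
  proof (rule integral_mono)
    show "integrable M (\<lambda>\<omega>. (D \<omega> + T \<omega>)\<^sup>2)" unfolding split[symmetric] by (rule centred_form_square_integrable)
    show "integrable M (\<lambda>\<omega>. 2 * (D \<omega>)\<^sup>2 + 2 * (T \<omega>)\<^sup>2)" using D_int T_int by simp
    show "(D \<omega> + T \<omega>)\<^sup>2 \<le> 2 * (D \<omega>)\<^sup>2 + 2 * (T \<omega>)\<^sup>2" for \<omega>
      using zero_le_power2[of "D \<omega> - T \<omega>"] by (simp add: power2_eq_square algebra_simps)
  qed
  moreover have "expectation (\<lambda>\<omega>. 2 * (D \<omega>)\<^sup>2 + 2 * (T \<omega>)\<^sup>2) = 2 * expectation (\<lambda>\<omega>. (D \<omega>)\<^sup>2) + 2 * expectation (\<lambda>\<omega>. (T \<omega>)\<^sup>2)"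
    using D_int T_int by simp
  ultimately show ?thesis unfolding split by (simp add: algebra_simps)
qed

end

text \<open>The remainder \<open>G / n\<close> collects the variance of the diagonal terms, the summand 1 in the
  bound for quadratic forms, and the part of the bias that comes from the finite sample. The smoothing bias
  is kept exactly, as its limit is needed with the sharp constant.\<close>

lemma mse_bound_finite_sample:
  fixes M :: "'a measure" and X :: "int \<Rightarrow> 'a \<Rightarrow> real"
  assumes "prob_space M" and stat: "weakly_stationary M X"
    and mean0: "\<forall>t. (\<integral>\<omega>. X t \<omega> \<partial>M) = 0" and X2: "\<forall>t. (\<integral>\<omega>. (X t \<omega>)\<^sup>2 \<partial>M) \<le> 1"
    and dep: "dependence_bounds M X \<phi> \<psi>" and fin: "finite_Phis M X \<phi> \<psi>"
    and ker: "kernel_conditions K q kq"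
  defines "\<gamma> \<equiv> \<lambda>j. cov M (X 0) (X (int (Suc j)))"
  defines "J \<equiv> (LINT x:{0..}|lborel. (Kbar K x)\<^sup>2)"
  obtains G where "\<And>m n. 0 < m \<Longrightarrow> 1 \<le> n \<Longrightarrow> mse M K X m n \<le>
      14400 * (Phi0 M X + Phi1 \<phi> + Phi2 \<psi>) * (m / real n) * J
      + (2 * (\<Sum>j. (K (real (Suc j) / m) - 1) * \<gamma> j))\<^sup>2 + G / real n"
proof -
  interpret prob_space M by fact
  have bdd: "bdd_above ((\<lambda>x. \<bar>K x\<bar>) ` {0..})" and K0: "K 0 = 1" using ker by (auto simp: kernel_conditions_def)
  have [measurable]: "X t \<in> borel_measurable M" and X1_int: "integrable M (X t)" for t
    using stat by (auto simp: weakly_stationary_def)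
  have X4_int: "integrable M (\<lambda>\<omega>. X t \<omega> ^ 4)" for t using fin by (auto simp: finite_Phis_def)
  have phi_nonneg: "0 \<le> \<phi> k" if "1 \<le> k" for k using dep that by (auto simp: dependence_bounds_def)
  have psi_nonneg: "0 \<le> \<psi> k" if "1 \<le> k" for k using dep that by (auto simp: dependence_bounds_def)
  have psi_sum: "(\<Sum>k<N. \<psi> (Suc k)) \<le> Phi2 \<psi>" for N
    unfolding Phi2_def using fin psi_nonneg by (intro sum_le_suminf) (auto simp: finite_Phis_def)
  have cov0: "cov M (X i) Y = expectation (\<lambda>\<omega>. X i \<omega> * Y \<omega>)" "cov M Y (X i) = expectation (\<lambda>\<omega>. Y \<omega> * X i \<omega>)"
    if "integrable M (\<lambda>\<omega>. X i \<omega> * Y \<omega>)" for i Y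
  proof -
    show 1: "cov M (X i) Y = expectation (\<lambda>\<omega>. X i \<omega> * Y \<omega>)"
      using that X1_int[of i] mean0 by (simp add: cov_def right_diff_distrib)
    then show "cov M Y (X i) = expectation (\<lambda>\<omega>. Y \<omega> * X i \<omega>)" by (simp add: cov_commute mult.commute)
  qed
  have db: "\<bar>cov M (X i) (\<lambda>\<omega>. X j \<omega> * X k \<omega> * X l \<omega>)\<bar> \<le> \<phi> (nat (j - i))"
      "\<bar>cov M (\<lambda>\<omega>. X i \<omega> * X j \<omega> * X k \<omega>) (X l)\<bar> \<le> \<phi> (nat (l - k))"
      "\<bar>cov M (\<lambda>\<omega>. X i \<omega> * X j \<omega>) (\<lambda>\<omega>. X k \<omega> * X l \<omega>)\<bar> \<le> \<phi> (nat (k - j))"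
      "\<bar>cov M (X i) (X j)\<bar> \<le> \<phi> (nat (j - i))" if "i < j" "j < k" "k < l" for i j k l
    using dep that unfolding dependence_bounds_def by auto
  have Phi0: "expectation (\<lambda>\<omega>. X t \<omega> ^ 4) \<le> Phi0 M X" for t
    unfolding Phi0_def using fin by (intro cSUP_upper) (auto simp: finite_Phis_def)
  interpret bounded_fourth_moments M X "Phi0 M X"
    by unfold_locales (use X4_int X2 Phi0 in auto)
  have Phi1: "(\<Sum>k<N. real (Suc k) * \<phi> (Suc k)) \<le> Phi1 \<phi>" for N
    unfolding Phi1_def using fin phi_nonneg by (intro sum_le_suminf) (auto simp: finite_Phis_def)
  interpret weakly_dependent_series M X "Phi0 M X" \<phi> "Phi1 \<phi>"
  proof unfold_locales
    fix i j k l :: int assume o: "i < j" "j < k" "k < l"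
    have p4: "integrable M (\<lambda>\<omega>. X i \<omega> * (X j \<omega> * X k \<omega> * X l \<omega>))"
      using prod4_integrable[of i j k l] by (simp add: mult.assoc)
    show "\<bar>expectation (\<lambda>\<omega>. X i \<omega> * X j \<omega> * X k \<omega> * X l \<omega>)\<bar> \<le> \<phi> (nat (j - i))"
      using db(1)[OF o] cov0(1)[OF p4] by (simp add: mult.assoc)
    have p4': "integrable M (\<lambda>\<omega>. X l \<omega> * (X i \<omega> * X j \<omega> * X k \<omega>))"
      using prod4_integrable[of l i j k] by (simp add: mult.assoc)
    show "\<bar>expectation (\<lambda>\<omega>. X i \<omega> * X j \<omega> * X k \<omega> * X l \<omega>)\<bar> \<le> \<phi> (nat (l - k))"
      using db(2)[OF o] cov0(2)[OF p4'] by simp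
    show "\<bar>expectation (\<lambda>\<omega>. X i \<omega> * X j \<omega> * X k \<omega> * X l \<omega>)
        - expectation (\<lambda>\<omega>. X i \<omega> * X j \<omega>) * expectation (\<lambda>\<omega>. X k \<omega> * X l \<omega>)\<bar> \<le> \<phi> (nat (k - j))"
      using db(3)[OF o] cov_eq_expectation[OF prod2_integrable[of i j] prod2_integrable[of k l]]
        prod4_integrable[of i j k l] by (simp add: mult.assoc)
  next
    fix i j :: int assume "i < j"
    then show "\<bar>expectation (\<lambda>\<omega>. X i \<omega> * X j \<omega>)\<bar> \<le> \<phi> (nat (j - i))"
      using db(4)[of i j "j + 1" "j + 2"] cov0(1)[OF prod2_integrable] by simp
  qed (use dep phi_nonneg Phi1 in \<open>auto simp: dependence_bounds_def\<close>)

  define c where "c j = cov M (X 0) (X (int j))" for j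
  have cov_prod: "expectation (\<lambda>\<omega>. X s \<omega> * X t \<omega>) = c (nat \<bar>s - t\<bar>)" for s t
  proof -
    have shift: "cov M (X s) (X (s + j)) = cov M (X 0) (X j)" for s j
      using stat unfolding weakly_stationary_def by (metis add_0)
    have "cov M (X s) (X t) = c (nat \<bar>s - t\<bar>)"
    proof (cases "s \<le> t")
      case True
      then show ?thesis using shift[of s "t - s"] by (simp add: c_def)
    next
      case False
      then show ?thesis using shift[of t "s - t"] by (simp add: c_def cov_commute[of M "X s"])
    qed
    then show ?thesis using cov0(1)[OF prod2_integrable] by simp
  qed
  have gamma: "\<gamma> j = c (Suc j)" for j by (simp add: \<gamma>_def c_def)
  have c_le: "\<bar>c (Suc j)\<bar> \<le> \<phi> (Suc j)" for j
    using pair_gap[of 0 "int (Suc j)"] by (simp add: cov_prod nat_add_distrib)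
  have wsum: "summable (\<lambda>j. real (Suc j) * \<bar>c (Suc j)\<bar>)"
  proof (rule summable_comparison_test')
    show "summable (\<lambda>j. real (Suc j) * \<phi> (Suc j))" using fin by (simp add: finite_Phis_def)
    show "norm (real (Suc j) * \<bar>c (Suc j)\<bar>) \<le> real (Suc j) * \<phi> (Suc j)" for j
      using c_le[of j] by (simp add: mult_left_mono)
  qed
  have csum: "summable (\<lambda>j. \<bar>c (Suc j)\<bar>)"
  proof (rule summable_comparison_test'[OF wsum])
    fix j show "norm \<bar>c (Suc j)\<bar> \<le> real (Suc j) * \<bar>c (Suc j)\<bar>"
      using mult_right_mono[of 1 "real (Suc j)" "\<bar>c (Suc j)\<bar>"] by simp
  qed
  have lrv: "long_run_variance M X = c 0 + 2 * (\<Sum>j. c (Suc j))"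
  proof -
    have e: "cov M (X 0) (X j) = c (nat \<bar>j\<bar>)" for j
      using cov0(1)[OF prod2_integrable[of 0 j]] cov_prod[of 0 j] by simp
    show ?thesis unfolding long_run_variance_def e
      using infsum_even_int[of "\<lambda>j. c (nat \<bar>j\<bar>)"] csum by (simp add: nat_add_distrib)
  qed

  define B where "B = Kbar K 0"
  have B: "\<bar>K x\<bar> \<le> B" if "0 \<le> x" for x unfolding B_def using abs_le_Kbar[OF bdd, of 0 x] that by simp
  have B0: "0 \<le> B" using B[of 0] by simp
  define W where "W = (\<Sum>j. real (Suc j) * \<bar>c (Suc j)\<bar>)"
  define G1 where "G1 = 2 * ((B + 1) * (\<Sum>j. \<bar>c (Suc j)\<bar>))"
  define G2 where "G2 = 2 * (B * W)"
  define G3 where "G3 = 2 * (Phi0 M X + 2 * Phi2 \<psi>) + 14400 * (Phi0 M X + Phi1 \<phi>)"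
  show ?thesis
  proof (rule that[of "2 * G1 * G2 + G2\<^sup>2 + G3"])
    fix m :: real and n :: nat assume m: "0 < m" and n: "1 \<le> n"
    define \<kappa> where "\<kappa> j = K (real j / m)" for j
    have kappa_le: "\<bar>\<kappa> j\<bar> \<le> B" for j unfolding \<kappa>_def using m by (intro B) auto
    define I where "I = {1..int n}"
    define V where "V \<omega> = (\<Sum>s\<in>I. \<Sum>t\<in>I. \<kappa> (nat \<bar>s - t\<bar>) * centred_product s t \<omega>)" for \<omega>
    define \<mu> where "\<mu> = (\<Sum>s\<in>I. \<Sum>t\<in>I. \<kappa> (nat \<bar>s - t\<bar>) * c (nat \<bar>s - t\<bar>)) / real n"
    define bias where "bias = \<mu> - long_run_variance M X"
    define \<beta> where "\<beta> = 2 * (\<Sum>j. (K (real (Suc j) / m) - 1) * \<gamma> j)"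

    have err: "lrv_estimator K X m n \<omega> - long_run_variance M X = V \<omega> / real n + bias" for \<omega>
    proof -
      have "K (real_of_int \<bar>s - t\<bar> / m) * X s \<omega> * X t \<omega>
        = \<kappa> (nat \<bar>s - t\<bar>) * centred_product s t \<omega> + \<kappa> (nat \<bar>s - t\<bar>) * c (nat \<bar>s - t\<bar>)" for s t
        by (simp add: \<kappa>_def centred_product_def cov_prod algebra_simps)
      then have "lrv_estimator K X m n \<omega> = V \<omega> / real n + \<mu>"
        by (simp add: lrv_estimator_def V_def \<mu>_def I_def sum.distrib add_divide_distrib)
      then show ?thesis by (simp add: bias_def)
    qed
    have V_int: "integrable M V" and V_E: "expectation V = 0"
      unfolding V_def[abs_def] using centred_product_integrable expectation_centred_product by simp_all
    have V2_int: "integrable M (\<lambda>\<omega>. (V \<omega>)\<^sup>2)"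
      unfolding V_def by (rule centred_form_square_integrable)
    have "mse M K X m n = expectation (\<lambda>\<omega>. (V \<omega>)\<^sup>2 / (real n)\<^sup>2 + 2 * bias / real n * V \<omega> + bias\<^sup>2)"
      unfolding mse_def err by (simp add: power2_sum power_divide algebra_simps)
    also have "\<dots> = expectation (\<lambda>\<omega>. (V \<omega>)\<^sup>2) / (real n)\<^sup>2 + bias\<^sup>2"
      using V2_int V_int by (simp add: V_E prob_space)
    finally have mse: "mse M K X m n = expectation (\<lambda>\<omega>. (V \<omega>)\<^sup>2) / (real n)\<^sup>2 + bias\<^sup>2" .

    have "expectation (\<lambda>\<omega>. (V \<omega>)\<^sup>2) \<le> real (card I) * (2 * (Phi0 M X + 2 * Phi2 \<psi>) + 14400 * (Phi0 M X + Phi1 \<phi>) * (m * J + 1))"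
      unfolding V_def
    proof (rule estimator_variance_le[where b="\<lambda>j. Kbar K (real j / m)" and \<psi>=\<psi> and ?P2.0="Phi2 \<psi>"])
      show "\<bar>\<kappa> k\<bar> \<le> Kbar K (real k / m)" for k unfolding \<kappa>_def using m by (intro abs_le_Kbar[OF bdd]) auto
      show "(\<Sum>k<N. (Kbar K (real (Suc k) / m))\<^sup>2) \<le> m * J" for N unfolding J_def by (rule sum_Kbar_sq_le[OF ker m])
      show "Kbar K (real l / m) \<le> Kbar K (real k / m)" if "k \<le> l" for k l
        using m that by (intro Kbar_antimono[OF bdd] divide_right_mono) auto
    qed (use psi_nonneg psi_sum dep K0 in \<open>auto simp: I_def \<kappa>_def dependence_bounds_def\<close>)
    also have "\<dots> = real n * (G3 + 14400 * (Phi0 M X + Phi1 \<phi>) * (m * J))"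
      by (simp add: I_def G3_def algebra_simps)
    finally have "expectation (\<lambda>\<omega>. (V \<omega>)\<^sup>2) / (real n)\<^sup>2 \<le> real n * (G3 + 14400 * (Phi0 M X + Phi1 \<phi>) * (m * J)) / (real n)\<^sup>2"
      by (intro divide_right_mono) auto
    also have "\<dots> = 14400 * (Phi0 M X + Phi1 \<phi>) * (m / real n) * J + G3 / real n"
      using n by (simp add: power2_eq_square field_simps)
    also have "\<dots> \<le> 14400 * (Phi0 M X + Phi1 \<phi> + Phi2 \<psi>) * (m / real n) * J + G3 / real n"
    proof -
      have "0 \<le> J" unfolding J_def set_lebesgue_integral_def by (intro integral_nonneg_AE AE_I2) auto
      moreover have "0 \<le> Phi2 \<psi>" using psi_sum[of 0] by simp
      ultimately show ?thesis using m by (intro add_right_mono mult_right_mono mult_left_mono) auto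
    qed
    finally have var: "expectation (\<lambda>\<omega>. (V \<omega>)\<^sup>2) / (real n)\<^sup>2
      \<le> 14400 * (Phi0 M X + Phi1 \<phi> + Phi2 \<psi>) * (m / real n) * J + G3 / real n" .

    have ksum: "summable (\<lambda>j. \<kappa> (Suc j) * c (Suc j))"
      by (rule summable_comparison_test'[OF summable_mult[OF csum, of B]])
         (use kappa_le in \<open>auto simp: abs_mult intro!: mult_right_mono\<close>)
    have csum': "summable (\<lambda>j. c (Suc j))" using csum by (rule summable_rabs_cancel)
    have beta_eq: "\<beta> = 2 * (\<Sum>j. \<kappa> (Suc j) * c (Suc j)) - 2 * (\<Sum>j. c (Suc j))"
      unfolding \<beta>_def gamma \<kappa>_def[symmetric] left_diff_distrib
      by (simp add: suminf_diff[OF ksum csum', symmetric] right_diff_distrib)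
    \<comment> \<open>A bound on the smoothing bias that is uniform in \<open>m\<close> makes the cross term in the square of the bias \<open>O(1 / n)\<close>.\<close>
    have beta_le: "\<bar>\<beta>\<bar> \<le> G1"
    proof -
      have "norm ((\<kappa> (Suc j) - 1) * c (Suc j)) \<le> (B + 1) * \<bar>c (Suc j)\<bar>" for j
        unfolding real_norm_def abs_mult using kappa_le[of "Suc j"] by (intro mult_right_mono) auto
      then have "\<bar>\<Sum>j. (\<kappa> (Suc j) - 1) * c (Suc j)\<bar> \<le> (\<Sum>j. (B + 1) * \<bar>c (Suc j)\<bar>)"
        by (intro norm_suminf_le[where 'a=real, unfolded real_norm_def] summable_mult csum) auto
      also have "\<dots> = (B + 1) * (\<Sum>j. \<bar>c (Suc j)\<bar>)" by (rule suminf_mult[OF csum])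
      finally show ?thesis unfolding \<beta>_def G1_def gamma \<kappa>_def[symmetric] by simp
    qed
    have e: "\<bar>bias - \<beta>\<bar> \<le> G2 / real n"
    proof -
      let ?h = "\<lambda>j. \<kappa> j * c j"
      have le: "real (Suc j) * \<bar>?h (Suc j)\<bar> \<le> B * (real (Suc j) * \<bar>c (Suc j)\<bar>)" for j
        using mult_right_mono[OF kappa_le[of "Suc j"], of "real (Suc j) * \<bar>c (Suc j)\<bar>"]
        by (simp add: abs_mult mult_ac)
      have hsum: "summable (\<lambda>j. real (Suc j) * \<bar>?h (Suc j)\<bar>)"
        by (rule summable_comparison_test'[OF summable_mult[OF wsum, of B]]) (use le in auto)
      have "(\<Sum>j. real (Suc j) * \<bar>?h (Suc j)\<bar>) \<le> (\<Sum>j. B * (real (Suc j) * \<bar>c (Suc j)\<bar>))"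
        by (intro suminf_le le hsum summable_mult wsum)
      also have "\<dots> = B * W" unfolding W_def by (rule suminf_mult[OF wsum])
      finally have "\<bar>real n * \<mu> - real n * (c 0 + 2 * (\<Sum>j. ?h (Suc j)))\<bar> \<le> G2"
        using toeplitz_sum_approx[OF hsum, of n] n K0 unfolding G2_def \<mu>_def I_def by (simp add: \<kappa>_def)
      moreover have "real n * \<mu> - real n * (c 0 + 2 * (\<Sum>j. ?h (Suc j))) = real n * (bias - \<beta>)"
        by (simp add: bias_def lrv beta_eq algebra_simps)
      ultimately have "\<bar>real n * (bias - \<beta>)\<bar> \<le> G2" by (simp only:)
      then have "real n * \<bar>bias - \<beta>\<bar> \<le> G2" by (simp only: abs_mult abs_of_nat)
      then show ?thesis using n by (simp add: le_divide_eq mult.commute)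
    qed
    have "bias\<^sup>2 \<le> \<beta>\<^sup>2 + (2 * G1 * G2 + G2\<^sup>2) / real n"
    proof -
      have G2: "0 \<le> G2"
        unfolding G2_def W_def using B0 wsum by (intro mult_nonneg_nonneg suminf_nonneg) auto
      have "bias\<^sup>2 = \<beta>\<^sup>2 + 2 * (\<beta> * (bias - \<beta>)) + (bias - \<beta>)\<^sup>2" by (simp add: power2_eq_square algebra_simps)
      moreover have "\<beta> * (bias - \<beta>) \<le> G1 * (G2 / real n)"
      proof -
        have "\<beta> * (bias - \<beta>) \<le> \<bar>\<beta>\<bar> * \<bar>bias - \<beta>\<bar>" unfolding abs_mult[symmetric] by simp
        also have "\<dots> \<le> G1 * (G2 / real n)" using beta_le e by (intro mult_mono) auto
        finally show ?thesis .
      qed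
      moreover have "(bias - \<beta>)\<^sup>2 \<le> G2\<^sup>2 / real n"
      proof -
        have "(bias - \<beta>)\<^sup>2 = \<bar>bias - \<beta>\<bar> * \<bar>bias - \<beta>\<bar>" by (simp add: power2_eq_square)
        also have "\<dots> \<le> (G2 / real n) * (G2 / 1)"
          using e G2 n by (intro mult_mono order_trans[OF e] divide_left_mono) auto
        finally show ?thesis by (simp add: power2_eq_square)
      qed
      ultimately show ?thesis by (simp add: add_divide_distrib)
    qed
    then show "mse M K X m n \<le>
      14400 * (Phi0 M X + Phi1 \<phi> + Phi2 \<psi>) * (m / real n) * J
      + (2 * (\<Sum>j. (K (real (Suc j) / m) - 1) * \<gamma> j))\<^sup>2 + (2 * G1 * G2 + G2\<^sup>2 + G3) / real n"
      using var unfolding mse \<beta>_def[symmetric] by (simp add: add_divide_distrib)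
  qed
qed

section \<open>The absolute constant\<close>

text \<open>The squared smoothing bias differs from its limiting form by \<open>o(m powr (- 2 * q))\<close>; that
  difference is taken as the remainder \<open>R\<close>.\<close>

lemma mse_bound_constant_14400: "mse_bound_constant TYPE('a) 14400"
  unfolding mse_bound_constant_def
proof (intro allI impI, goal_cases)
  case (1 M X \<phi> \<psi> K q kq)
  define S where "S m = (\<Sum>j. (K (real (Suc j) / m) - 1) * cov M (X 0) (X (int (Suc j))))" for m
  define \<Gamma> where "\<Gamma> = (\<Sum>j. Gamma_term M X q j)"
  obtain G where G: "\<And>m n. 0 < m \<Longrightarrow> 1 \<le> n \<Longrightarrow> mse M K X m n \<le>
      14400 * (Phi0 M X + Phi1 \<phi> + Phi2 \<psi>) * (m / real n) * (LINT x:{0..}|lborel. (Kbar K x)\<^sup>2)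
      + (2 * S m)\<^sup>2 + G / real n"
    unfolding S_def by (rule mse_bound_finite_sample[OF 1(1-7)]) blast
  have S_lim: "((\<lambda>m. m powr q * S m) \<longlongrightarrow> kq * \<Gamma>) at_top"
    unfolding S_def \<Gamma>_def Gamma_term_def
    by (rule kernel_bias_tendsto[OF 1(7)]) (use 1(8) in \<open>simp only: Gamma_term_def\<close>)
  define R :: "real \<times> nat \<Rightarrow> real" where "R = (\<lambda>(m, n). (2 * S m)\<^sup>2 - 4 * (kq * \<Gamma>)\<^sup>2 / m powr (2 * q))"
  define E :: "real \<times> nat \<Rightarrow> real" where "E = (\<lambda>(m, n). G / real n)"
  have pos: "\<forall>\<^sub>F (m :: real, n :: nat) in at_top \<times>\<^sub>F at_top. 0 < m"
    by (rule iffD2[OF eventually_prod1 eventually_gt_at_top]) simp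
  have pos': "\<forall>\<^sub>F (m :: real, n :: nat) in at_top \<times>\<^sub>F at_top. 1 \<le> n"
    by (rule iffD2[OF eventually_prod2 eventually_ge_at_top]) simp
  have "((\<lambda>m. 4 * (m powr q * S m)\<^sup>2 - 4 * (kq * \<Gamma>)\<^sup>2) \<longlongrightarrow> 4 * (kq * \<Gamma>)\<^sup>2 - 4 * (kq * \<Gamma>)\<^sup>2) at_top"
    by (intro tendsto_intros S_lim)
  then have "((\<lambda>x. 4 * (fst x powr q * S (fst x))\<^sup>2 - 4 * (kq * \<Gamma>)\<^sup>2) \<longlongrightarrow> 0) (at_top \<times>\<^sub>F (at_top :: nat filter))"
    using filterlim_compose[OF _ filterlim_fst] by simp
  then have "((\<lambda>x. R x / (case x of (m, n) \<Rightarrow> m powr (- 2 * q))) \<longlongrightarrow> 0) (at_top \<times>\<^sub>F at_top)"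
  proof (rule Lim_transform_eventually)
    have "4 * (m powr q * S m)\<^sup>2 - 4 * (kq * \<Gamma>)\<^sup>2 = R (m, n) / m powr (- 2 * q)" if "0 < m" for m n
    proof -
      have "m powr (2 * q) = (m powr q)\<^sup>2" using that by (simp add: powr_power mult.commute)
      then show ?thesis using that by (simp add: R_def powr_minus field_simps power_mult_distrib)
    qed
    then show "\<forall>\<^sub>F x in at_top \<times>\<^sub>F at_top. 4 * (fst x powr q * S (fst x))\<^sup>2 - 4 * (kq * \<Gamma>)\<^sup>2
        = R x / (case x of (m, n) \<Rightarrow> m powr (- 2 * q))"
      by (intro eventually_mono[OF pos]) auto
  qed
  then have R: "R \<in> o[at_top \<times>\<^sub>F at_top](\<lambda>(m, n). m powr (- 2 * q))"
    by (rule smalloI_tendsto) (auto intro: eventually_mono[OF pos])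
  have E: "E \<in> O[at_top \<times>\<^sub>F at_top](\<lambda>(m, n). 1 / real n)"
    by (rule bigoI[where c="\<bar>G\<bar>"]) (auto simp: E_def split_def intro!: always_eventually)
  have "\<forall>\<^sub>F (m, n) in at_top \<times>\<^sub>F at_top. mse M K X m n \<le>
      14400 * (Phi0 M X + Phi1 \<phi> + Phi2 \<psi>) * (m / real n) * (LINT x:{0..}|lborel. (Kbar K x)\<^sup>2)
      + 4 * (kq * \<Gamma>)\<^sup>2 / m powr (2 * q) + R (m, n) + E (m, n)"
    using pos pos' by eventually_elim (use G in \<open>auto simp: R_def E_def\<close>)
  then show ?case using R E unfolding \<Gamma>_def by blast
qed

text \<open>The law of the series on the path space, with the coordinate process, has the same moments,
  covariances and mean squared errors as the series itself.\<close>

lemma mse_bound_constant_path_space: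
  assumes C: "mse_bound_constant TYPE(int \<Rightarrow> real) C"
  shows "mse_bound_constant TYPE('a) C"
  unfolding mse_bound_constant_def
proof (intro allI impI, goal_cases)
  case (1 M X \<phi> \<psi> K q kq)
  interpret prob_space M by (rule 1(1))
  define g where "g \<omega> t = X t \<omega>" for \<omega> and t :: int
  define N :: "(int \<Rightarrow> real) measure" where "N = distr M (Pi\<^sub>M UNIV (\<lambda>_. borel)) g"
  define Y where "Y t x = x t" for t :: int and x :: "int \<Rightarrow> real"
  have Xm: "X t \<in> borel_measurable M" for t using 1(2) by (simp add: weakly_stationary_def)
  have g: "g \<in> measurable M (Pi\<^sub>M UNIV (\<lambda>_. borel))"
    by (rule measurable_PiM_single') (use Xm in \<open>auto simp: g_def[abs_def]\<close>)
  have Y [measurable]: "Y t \<in> borel_measurable (Pi\<^sub>M UNIV (\<lambda>_. borel))" for t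
    unfolding Y_def[abs_def] by (rule measurable_component_singleton) simp
  have YN: "Y t \<in> borel_measurable N" for t using Y by (simp add: N_def)
  have Yg: "Y t (g \<omega>) = X t \<omega>" for t \<omega> by (simp add: Y_def g_def)
  have int: "integral\<^sup>L N f = integral\<^sup>L M (\<lambda>\<omega>. f (g \<omega>))"
    and intble: "integrable N f \<longleftrightarrow> integrable M (\<lambda>\<omega>. f (g \<omega>))"
    if "f \<in> borel_measurable (Pi\<^sub>M UNIV (\<lambda>_. borel))" for f :: "_ \<Rightarrow> real"
    unfolding N_def using that by (auto intro!: integral_distr integrable_distr_eq g)
  have cov: "cov N f h = cov M (\<lambda>\<omega>. f (g \<omega>)) (\<lambda>\<omega>. h (g \<omega>))"
    if [measurable]: "f \<in> borel_measurable (Pi\<^sub>M UNIV (\<lambda>_. borel))" "h \<in> borel_measurable (Pi\<^sub>M UNIV (\<lambda>_. borel))"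
    for f h :: "_ \<Rightarrow> real"
    unfolding cov_def int[OF that(1)] int[OF that(2)] by (rule int) measurable
  have covY: "cov N (Y s) (Y t) = cov M (X s) (X t)" for s t
    by (simp add: cov Yg)
  have prob: "prob_space N" unfolding N_def by (rule prob_space_distr[OF g])
  have stat: "weakly_stationary N Y"
    using 1(2) YN by (simp add: weakly_stationary_def intble int Yg covY)
  have cov_products:
    "cov N (Y i) (\<lambda>x. Y j x * Y k x * Y l x) = cov M (X i) (\<lambda>\<omega>. X j \<omega> * X k \<omega> * X l \<omega>)"
    "cov N (\<lambda>x. Y i x * Y j x * Y k x) (Y l) = cov M (\<lambda>\<omega>. X i \<omega> * X j \<omega> * X k \<omega>) (X l)"
    "cov N (\<lambda>x. Y i x * Y j x) (\<lambda>x. Y k x * Y l x) = cov M (\<lambda>\<omega>. X i \<omega> * X j \<omega>) (\<lambda>\<omega>. X k \<omega> * X l \<omega>)"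
    "cov N (\<lambda>x. (Y i x)\<^sup>2) (\<lambda>x. (Y j x)\<^sup>2) = cov M (\<lambda>\<omega>. (X i \<omega>)\<^sup>2) (\<lambda>\<omega>. (X j \<omega>)\<^sup>2)" for i j k l
    by (simp_all add: cov Yg)
  have dep: "dependence_bounds N Y \<phi> \<psi>"
    using 1(5) unfolding dependence_bounds_def cov_products covY .
  have Phi0: "Phi0 N Y = Phi0 M X" by (simp add: Phi0_def int Yg)
  have fin: "finite_Phis N Y \<phi> \<psi>"
    using 1(6) by (simp add: finite_Phis_def int intble Yg)
  have Gamma: "Gamma_term N Y q = Gamma_term M X q"
    by (simp add: Gamma_term_def covY fun_eq_iff)
  have lrv: "long_run_variance N Y = long_run_variance M X" by (simp add: long_run_variance_def covY)
  have mse: "mse N K Y m n = mse M K X m n" for m n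
  proof -
    have "lrv_estimator K Y m n \<in> borel_measurable (Pi\<^sub>M UNIV (\<lambda>_. borel))"
      unfolding lrv_estimator_def[abs_def] by measurable
    then show ?thesis unfolding mse_def lrv by (subst int) (auto simp: lrv_estimator_def Yg)
  qed
  from C[unfolded mse_bound_constant_def, rule_format, OF prob stat _ _ dep fin 1(7), unfolded Gamma Phi0 mse] 
  show ?case using 1(3,4,8) by (simp add: int Yg)
qed

theorem theorem3p3:
  shows "(\<exists>C>0. mse_bound_constant TYPE(int \<Rightarrow> real) C) \<and>
         (\<forall>C. mse_bound_constant TYPE(int \<Rightarrow> real) C \<longrightarrow> mse_bound_constant TYPE('a) C)"
proof (intro conjI allI impI)
  show "\<exists>C>0. mse_bound_constant TYPE(int \<Rightarrow> real) C"
    by (rule exI[of _ 14400]) (simp add: mse_bound_constant_14400)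
qed (rule mse_bound_constant_path_space)

end
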